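(* Let $G$ be a countable discrete infinite amenable group, $(X,G)$ a $G$-system, $n\ge2$ and $\mu\in\mathcal{M}(X,G)$. Then $$E_n^\mu(X,G)=\text{supp}(\lambda_n(\mu))\setminus\Delta_n(X).$$
   Context: Let $F(G)$ be the set of non-empty finite subsets of $G$. A sequence $\{F_n\}_{n\in\mathbb{N}}\subseteq F(G)$ is a Følner sequence if for all $K\in F(G)$ and $\delta>0$ one has $|K^{-1}F_n\cap K^{-1}(G\setminus F_n)|<\delta|F_n|$ for all large $n$. A $G$-system $(X,G)$ is a compact metric space $X$ with a continuous action $G\times X\to X$. $\mathcal{M}(X,G)$ is the set of $G$-invariant Borel probability measures on $X$; $\mathcal{B}_X^\mu$ is the completion of the Borel $\sigma$-algebra under $\mu$. For a finite measurable partition $\alpha$ of $X$, $h_\mu(G,\alpha)=\lim_{m\to+\infty}\frac{1}{|F_m|}H_\mu(\bigvee_{g\in F_m}g^{-1}\alpha)$, where $H_\mu(\alpha)=\sum_{A\in\alpha}-\mu(A)\log\mu(A)$; the limit exists and does not depend on the Følner sequence $\{F_m\}$. $X^{(n)}=X\times\cdots\times X$ ($n$ times) and $\Delta_n(X)=\{(x_i)_1^n\in X^{(n)}:x_1=\cdots=x_n\}$. For $(x_i)_1^n\in X^{(n)}\setminus\Delta_n(X)$, a finite Borel cover $\mathcal{U}$ of $X$ is admissible w.r.t. $(x_i)_1^n$ if $\overline{U}\not\supseteq\{x_1,\dots,x_n\}$ for every $U\in\mathcal{U}$. $E_n^\mu(X,G)$ is the set of measure-theoretic entropy $n$-tuples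 for $\mu$, i.e. those $(x_i)_1^n\in X^{(n)}\setminus\Delta_n(X)$ such that $h_\mu(G,\alpha)>0$ for every finite Borel partition $\alpha$ of $X$ admissible w.r.t. $(x_i)_1^n$. $P_\mu=\{A\in\mathcal{B}_X^\mu:h_\mu(G,\{A,A^c\})=0\}$ is the Pinsker $\sigma$-algebra, and $\lambda_n(\mu)$ is the measure on $X^{(n)}$ determined by $\lambda_n(\mu)(\prod_{i=1}^nA_i)=\int_X\prod_{i=1}^n\mathbb{E}(1_{A_i}|P_\mu)\,d\mu$ for $A_1,\dots,A_n\in\mathcal{B}_X^\mu$. $\text{supp}$ denotes the (closed) support. *)

theory Defs
  imports "HOL-Algebra.Group_Action" "HOL-Probability.Probability"
begin

definition Folner_sequence :: "('g, 'b) monoid_scheme \<Rightarrow> (nat \<Rightarrow> 'g set) \<Rightarrow> bool" where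
  "Folner_sequence G F \<longleftrightarrow>
     (\<forall>n. finite (F n) \<and> F n \<noteq> {} \<and> F n \<subseteq> carrier G) \<and>
     (\<forall>K \<delta>. finite K \<and> K \<noteq> {} \<and> K \<subseteq> carrier G \<and> (\<delta>::real) > 0 \<longrightarrow>
        (\<forall>\<^sub>F n in sequentially.
           real (card ((set_inv\<^bsub>G\<^esub> K <#>\<^bsub>G\<^esub> F n) \<inter> (set_inv\<^bsub>G\<^esub> K <#>\<^bsub>G\<^esub> (carrier G - F n))))
             < \<delta> * real (card (F n))))"

text \<open>For a countable discrete group, amenability is the existence of a Folner sequence.\<close>

definition amenable :: "('g, 'b) monoid_scheme \<Rightarrow> bool" where
  "amenable G \<longleftrightarrow> (\<exists>F. Folner_sequence G F)"

text \<open>The space is the whole type \<open>'x\<close>; \<open>\<phi> g\<close> is the homeomorphism by which \<open>g\<close> acts.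
  Continuity is joint continuity, the group carrying the discrete topology.\<close>

definition G_system ::
    "('g, 'b) monoid_scheme \<Rightarrow> ('g \<Rightarrow> 'x::metric_space \<Rightarrow> 'x) \<Rightarrow> bool" where
  "G_system G \<phi> \<longleftrightarrow>
     compact (UNIV :: 'x set) \<and>
     group_action G UNIV \<phi> \<and>
     continuous_map (prod_topology (discrete_topology (carrier G)) euclidean) euclidean
       (\<lambda>(g, x). \<phi> g x)"

definition invariant_measures ::
    "('g, 'b) monoid_scheme \<Rightarrow> ('g \<Rightarrow> 'x::topological_space \<Rightarrow> 'x) \<Rightarrow> 'x measure set" where
  "invariant_measures G \<phi> =
     {\<mu>. prob_space \<mu> \<and> sets \<mu> = sets borel \<and> (\<forall>g\<in>carrier G. distr \<mu> borel (\<phi> g) = \<mu>)}"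

text \<open>Measures of sets are taken in the completion, so that the same definitions serve for
  Borel partitions and for partitions into sets of the completed \<open>\<sigma>\<close>-algebra.
  Empty cells, as in \<open>{A, - A}\<close> with \<open>A = {}\<close>, contribute \<open>0 * ln 0 = 0\<close>.\<close>

definition partition_entropy :: "'x measure \<Rightarrow> 'x set set \<Rightarrow> real" where
  "partition_entropy \<mu> \<alpha> =
     (\<Sum>A\<in>\<alpha>. - measure (completion \<mu>) A * ln (measure (completion \<mu>) A))"

text \<open>The join of the \<open>g\<^sup>-\<^sup>1 \<alpha>\<close> for \<open>g\<close> in \<open>F\<close>; a choice function \<open>c\<close> picks one cell of \<open>\<alpha>\<close>
  for each \<open>g\<close>.\<close>

definition dynamical_join :: "('g \<Rightarrow> 'x \<Rightarrow> 'x) \<Rightarrow> 'g set \<Rightarrow> 'x set set \<Rightarrow> 'x set set" where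
  "dynamical_join \<phi> F \<alpha> = (\<lambda>c. \<Inter>g\<in>F. \<phi> g -` c g) ` (F \<rightarrow>\<^sub>E \<alpha>)"

text \<open>The common limit along all Folner sequences.\<close>

definition entropy_of_partition ::
    "('g, 'b) monoid_scheme \<Rightarrow> ('g \<Rightarrow> 'x \<Rightarrow> 'x) \<Rightarrow> 'x measure \<Rightarrow> 'x set set \<Rightarrow> real" where
  "entropy_of_partition G \<phi> \<mu> \<alpha> =
     (THE h. \<forall>F. Folner_sequence G F \<longrightarrow>
        (\<lambda>m. partition_entropy \<mu> (dynamical_join \<phi> (F m) \<alpha>) / real (card (F m)))
          \<longlonglongrightarrow> h)"

text \<open>The \<open>n\<close>-fold power of the space consists of the extensional functions on \<open>{1..n}\<close>.\<close>

definition tuples :: "nat \<Rightarrow> (nat \<Rightarrow> 'x) set" where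
  "tuples n = {1..n} \<rightarrow>\<^sub>E UNIV"

definition diagonal :: "nat \<Rightarrow> (nat \<Rightarrow> 'x) set" where
  "diagonal n = {x \<in> tuples n. \<forall>i\<in>{1..n}. \<forall>j\<in>{1..n}. x i = x j}"

definition finite_Borel_cover :: "'x::topological_space set set \<Rightarrow> bool" where
  "finite_Borel_cover \<U> \<longleftrightarrow> finite \<U> \<and> \<U> \<subseteq> sets borel \<and> \<Union>\<U> = UNIV"

definition finite_Borel_partition :: "'x::topological_space set set \<Rightarrow> bool" where
  "finite_Borel_partition \<alpha> \<longleftrightarrow> finite \<alpha> \<and> \<alpha> \<subseteq> sets borel \<and> partition_on UNIV \<alpha>"

definition admissible :: "nat \<Rightarrow> (nat \<Rightarrow> 'x::topological_space) \<Rightarrow> 'x set set \<Rightarrow> bool" where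
  "admissible n x \<U> \<longleftrightarrow> finite_Borel_cover \<U> \<and> (\<forall>U\<in>\<U>. \<not> x ` {1..n} \<subseteq> closure U)"

definition entropy_tuples ::
    "('g, 'b) monoid_scheme \<Rightarrow> ('g \<Rightarrow> 'x::topological_space \<Rightarrow> 'x) \<Rightarrow> 'x measure \<Rightarrow> nat
      \<Rightarrow> (nat \<Rightarrow> 'x) set" where
  "entropy_tuples G \<phi> \<mu> n =
     {x \<in> tuples n - diagonal n.
        \<forall>\<alpha>. finite_Borel_partition \<alpha> \<and> admissible n x \<alpha> \<longrightarrow> entropy_of_partition G \<phi> \<mu> \<alpha> > 0}"

definition Pinsker_sets ::
    "('g, 'b) monoid_scheme \<Rightarrow> ('g \<Rightarrow> 'x \<Rightarrow> 'x) \<Rightarrow> 'x measure \<Rightarrow> 'x set set" where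
  "Pinsker_sets G \<phi> \<mu> =
     {A \<in> sets (completion \<mu>). entropy_of_partition G \<phi> \<mu> {A, - A} = 0}"

text \<open>Conditional expectations are taken with respect to a measure object, of which only the
  \<open>\<sigma>\<close>-algebra matters. The Pinsker sets already form a \<open>\<sigma>\<close>-algebra, so generating one
  from them adds nothing.\<close>

definition Pinsker_algebra ::
    "('g, 'b) monoid_scheme \<Rightarrow> ('g \<Rightarrow> 'x \<Rightarrow> 'x) \<Rightarrow> 'x measure \<Rightarrow> 'x measure" where
  "Pinsker_algebra G \<phi> \<mu> = sigma UNIV (Pinsker_sets G \<phi> \<mu>)"

text \<open>The measure on the \<open>n\<close>-fold product of the completed \<open>\<sigma>\<close>-algebra determined by its
  values on measurable rectangles.\<close>

definition lambda_measure ::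
    "('g, 'b) monoid_scheme \<Rightarrow> ('g \<Rightarrow> 'x \<Rightarrow> 'x) \<Rightarrow> 'x measure \<Rightarrow> nat \<Rightarrow> (nat \<Rightarrow> 'x) measure" where
  "lambda_measure G \<phi> \<mu> n =
     extend_measure (tuples n) ({1..n} \<rightarrow> sets (completion \<mu>)) (\<lambda>A. Pi\<^sub>E {1..n} A)
       (\<lambda>A. ennreal (\<integral>x. (\<Prod>i=1..n.
          real_cond_exp (completion \<mu>) (Pinsker_algebra G \<phi> \<mu>) (indicat_real (A i)) x)
          \<partial>completion \<mu>))"

text \<open>Closed support with respect to the product topology on \<open>n\<close>-tuples.\<close>

definition tuple_support :: "nat \<Rightarrow> (nat \<Rightarrow> 'x::topological_space) measure \<Rightarrow> (nat \<Rightarrow> 'x) set" where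
  "tuple_support n M =
     {x \<in> tuples n. \<forall>U. openin (product_topology (\<lambda>_. euclidean) {1..n}) U \<and> x \<in> U \<longrightarrow>
        emeasure M U > 0}"

end

theory Submission
  imports Defs
begin

text \<open>
  Write \<open>P\<close> for the \<open>\<sigma>\<close>-algebra of Pinsker sets and \<open>E(A)\<close> for the conditional expectation of the
  indicator of \<open>A\<close> given \<open>P\<close>. Both inclusions rest on one dichotomy for Borel sets
  \<open>U\<^sub>1, \<dots>, U\<^sub>n\<close>: the integral of \<open>E(U\<^sub>1) \<cdots> E(U\<^sub>n)\<close> vanishes exactly when each \<open>U\<^sub>i\<close>
  lies, up to null sets, in a Pinsker set \<open>D\<^sub>i\<close> such that \<open>D\<^sub>1 \<inter> \<dots> \<inter> D\<^sub>n\<close> is null.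

  If each \<open>U\<^sub>i\<close> is disjoint from a Pinsker set and these Pinsker sets cover the space, then every point
  lies in one of them, where the corresponding factor \<open>E(U\<^sub>i)\<close> is zero; hence the product vanishes
  (\<open>weight_eq_0_if_zero_entropy_cover\<close>). An admissible partition of zero entropy produces such a
  situation: the union of the cells whose closure misses \<open>x\<^sub>i\<close> is a Pinsker set, it avoids an open
  neighbourhood of \<open>x\<^sub>i\<close>, and admissibility says that these unions cover. So a point of the support
  admits no such partition.

  Conversely, let the integral vanish for open \<open>U\<^sub>i \<ni> x\<^sub>i\<close>, shrunk so that their intersection is empty
  (this is where \<open>x\<close> is off the diagonal). The set where \<open>E(U\<^sub>i) > 0\<close> contains \<open>U\<^sub>i\<close> up to a null
  set, and the intersection of these sets is null. Their complements, corrected on a null set, are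
  Pinsker sets that cover the space, the \<open>i\<close>-th one being disjoint from \<open>U\<^sub>i\<close>. Making this
  cover disjoint gives an admissible partition of zero entropy
  (\<open>zero_entropy_partition_if_weight_0\<close>), so \<open>x\<close> is not an entropy tuple.

  Two facts about the objects themselves have to be established on the way.
  The first is that the entropy limit exists and behaves well, which in turn shows that the Pinsker
  sets form a \<open>\<sigma>\<close>-algebra. The entropy of the join over a finite subset of the group is a monotone,
  submodular and right invariant function of that subset. Shearer's inequality then replaces any
  tiling argument: covering a Folner set by the right translates of a fixed finite set \<open>K\<close> bounds
  the normalised entropy by that of \<open>K\<close>, so the limit is an infimum over all \<open>K\<close>
  (\<open>Folner_limit_INF\<close>).
  The second is that the measure on tuples exists. No disintegration is used:
  on finitely many rectangles the prescribed values come, for almost every \<open>x\<close>, from a discrete product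
  measure, hence are finitely additive (\<open>prod_ce_discrete\<close>); the marginals equal \<open>\<mu>\<close>, which is
  regular, so compactness upgrades this to countable additivity (\<open>weight_le_suminf\<close>), and
  Caratheodory's theorem applies.
\<close>

section \<open>Entropy of finite-valued functions\<close>

text \<open>Shannon entropy of a partition, presented through a function \<open>f\<close> whose fibres are the cells: joins
  become tuples of functions, and a coarser partition is a function that factors through \<open>f\<close>.\<close>

definition label_entropy :: "'x measure \<Rightarrow> ('x \<Rightarrow> 'l) \<Rightarrow> real" where
  "label_entropy N f = (\<Sum>a\<in>range f. - measure N (f -` {a}) * ln (measure N (f -` {a})))"

text \<open>The only analytic input to submodularity: \<open>ln t \<le> t - 1\<close> at \<open>t = q r / (s p)\<close>.\<close>

lemma mul_ln_ratio_le:
  fixes p q r s :: real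
  assumes "0 \<le> p" "p \<le> q" "p \<le> r" "p \<le> s"
  shows "p * ln q + p * ln r - p * ln p - p * ln s \<le> q * r / s - p"
proof (cases "p = 0")
  case True
  then show ?thesis using assms by simp
next
  case False
  then have pos: "p > 0" "q > 0" "r > 0" "s > 0" using assms by auto
  have "p * ln (q * r / (s * p)) \<le> p * (q * r / (s * p) - 1)"
    using pos by (intro mult_left_mono ln_le_minus_one) auto
  also have "\<dots> = q * r / s - p" using pos by (simp add: field_simps)
  also have "p * ln (q * r / (s * p)) = p * ln q + p * ln r - p * ln p - p * ln s"
    using pos by (simp add: ln_div ln_mult algebra_simps)
  finally show ?thesis .
qed

text \<open>The pointwise estimate is summed over the matrix, comparing each entry with its row sum, its column sum
  and the total mass \<open>s\<close>. The error term cancels because the products of the row and column sums add up to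
  \<open>s\<^sup>2\<close>. No normalisation \<open>s = 1\<close> is imposed, so that the estimate can be applied to the part
  of the space where a third function takes a fixed value.\<close>

lemma entropy_matrix_le_marginals:
  fixes p :: "'a \<Rightarrow> 'b \<Rightarrow> real"
  assumes "finite A" "finite B" and nn: "\<And>a b. 0 \<le> p a b"
  defines "r \<equiv> \<lambda>a. \<Sum>b\<in>B. p a b" and "c \<equiv> \<lambda>b. \<Sum>a\<in>A. p a b"
  defines "s \<equiv> \<Sum>a\<in>A. \<Sum>b\<in>B. p a b"
  shows "(\<Sum>a\<in>A. \<Sum>b\<in>B. - p a b * ln (p a b)) - s * ln s
    \<le> (\<Sum>a\<in>A. - r a * ln (r a)) + (\<Sum>b\<in>B. - c b * ln (c b))"
proof -
  have s_r: "s = (\<Sum>a\<in>A. r a)" by (simp add: s_def r_def)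
  have s_c: "s = (\<Sum>b\<in>B. c b)" unfolding s_def c_def by (rule sum.swap)
  have r_nn: "0 \<le> r a" and c_nn: "0 \<le> c b" for a b
    by (auto simp: r_def c_def nn intro: sum_nonneg)
  have pr: "p a b \<le> r a" if "b \<in> B" for a b
    unfolding r_def using assms that by (intro member_le_sum) auto
  have pc: "p a b \<le> c b" if "a \<in> A" for a b
    unfolding c_def using assms that by (intro member_le_sum[of a A "\<lambda>a. p a b"]) auto
  have rs: "r a \<le> s" if "a \<in> A" for a
    unfolding s_r using assms that r_nn by (intro member_le_sum) auto
  have "(\<Sum>a\<in>A. \<Sum>b\<in>B. p a b * ln (r a) + p a b * ln (c b) - p a b * ln (p a b) - p a b * ln s)
     \<le> (\<Sum>a\<in>A. \<Sum>b\<in>B. r a * c b / s - p a b)"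
    by (intro sum_mono mul_ln_ratio_le nn pr pc order_trans[OF pr rs])
  also have "\<dots> = s * s / s - s"
  proof -
    have "(\<Sum>a\<in>A. \<Sum>b\<in>B. r a * c b / s) = (\<Sum>a\<in>A. r a) * (\<Sum>b\<in>B. c b) / s"
      by (simp only: sum_product sum_divide_distrib)
    then show ?thesis by (simp only: sum_subtractf s_def[symmetric] s_r[symmetric] s_c[symmetric])
  qed
  also have "\<dots> = 0" by simp
  also have "(\<Sum>a\<in>A. \<Sum>b\<in>B. p a b * ln (r a) + p a b * ln (c b) - p a b * ln (p a b) - p a b * ln s)
    = (\<Sum>a\<in>A. r a * ln (r a)) + (\<Sum>b\<in>B. c b * ln (c b))
      - (\<Sum>a\<in>A. \<Sum>b\<in>B. p a b * ln (p a b)) - s * ln s"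
  proof -
    have "(\<Sum>a\<in>A. \<Sum>b\<in>B. p a b * ln (c b)) = (\<Sum>b\<in>B. c b * ln (c b))"
      by (subst sum.swap) (simp add: c_def sum_distrib_right)
    moreover have "(\<Sum>a\<in>A. \<Sum>b\<in>B. p a b * ln (r a)) = (\<Sum>a\<in>A. r a * ln (r a))"
      by (simp add: r_def sum_distrib_right)
    moreover have "(\<Sum>a\<in>A. \<Sum>b\<in>B. p a b * ln s) = s * ln s"
      by (simp add: s_def sum_distrib_right)
    ultimately show ?thesis by (simp add: sum_subtractf sum.distrib)
  qed
  finally show ?thesis by (simp add: sum_negf)
qed

locale full_prob_space = prob_space N for N :: "'x measure" +
  assumes space_full [simp]: "space N = UNIV"
begin

lemma UNIV_sets [simp]: "UNIV \<in> sets N"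
  using sets.top[of N] by simp

lemma Compl_sets: "A \<in> sets N \<Longrightarrow> - A \<in> sets N"
  using sets.compl_sets[of A N] by (simp add: Compl_eq_Diff_UNIV)

lemma fibre_sets:
  assumes "simple_function N f" shows "f -` S \<in> sets N"
  using simple_functionD(2)[OF assms, of S] by simp

lemma range_finite: "simple_function N f \<Longrightarrow> finite (range f)"
  using simple_functionD(1) by fastforce

lemma label_entropy_sum:
  assumes "finite A" "range f \<subseteq> A"
  shows "label_entropy N f = (\<Sum>a\<in>A. - measure N (f -` {a}) * ln (measure N (f -` {a})))"
  unfolding label_entropy_def
proof (rule sum.mono_neutral_left[OF assms], rule ballI)
  fix a assume "a \<in> A - range f"
  then have "f -` {a} = {}" by auto
  then show "- measure N (f -` {a}) * ln (measure N (f -` {a})) = 0" by simp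
qed

lemma label_entropy_cong_inj:
  assumes "\<And>x y. f x = f y \<longleftrightarrow> g x = g y"
  shows "label_entropy N f = label_entropy N g"
proof -
  define k where "k a = g (SOME x. f x = a)" for a
  have k: "k (f x) = g x" for x
    unfolding k_def using assms someI[of "\<lambda>y. f y = f x" x] by blast
  have "inj_on k (range f)" by (auto simp: inj_on_def k assms)
  moreover have "range g = k ` range f" by (auto simp: k image_image)
  moreover have "g -` {k a} = f -` {a}" if "a \<in> range f" for a
    using that assms by (auto simp: k)
  ultimately show ?thesis
    unfolding label_entropy_def by (simp add: sum.reindex)
qed

lemma label_entropy_nonneg: "0 \<le> label_entropy N f"
  unfolding label_entropy_def
proof (intro sum_nonneg)
  fix a
  let ?m = "measure N (f -` {a})"
  have "?m = 0 \<or> ln ?m \<le> 0"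
    using prob_le_1[of "f -` {a}"] measure_nonneg[of N "f -` {a}"] by (cases "?m = 0") (auto simp: ln_le_zero_iff less_le simp del: measure_le_0_iff)
  then show "0 \<le> - ?m * ln ?m"
    using mult_nonneg_nonpos[of ?m "ln ?m"] by auto
qed

lemma label_entropy_const: "label_entropy N (\<lambda>_. a) = 0"
  using prob_space by (simp add: label_entropy_def)

text \<open>Conditional mutual information is nonnegative: for each value of \<open>h\<close> the joint masses of \<open>f\<close> and \<open>g\<close>
  form a matrix as above. Monotonicity and subadditivity of entropy are the special cases \<open>f = g\<close> and
  \<open>h\<close> constant.\<close>

lemma label_entropy_submodular:
  assumes f: "simple_function N f" and g: "simple_function N g" and h: "simple_function N h"
  shows "label_entropy N (\<lambda>x. (f x, g x, h x)) + label_entropy N h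
    \<le> label_entropy N (\<lambda>x. (f x, h x)) + label_entropy N (\<lambda>x. (g x, h x))"
proof -
  let ?A = "range f" and ?B = "range g" and ?C = "range h"
  let ?e = "\<lambda>t::real. - t * ln t"
  note fin = range_finite[OF f] range_finite[OF g] range_finite[OF h]
  define p where "p a b c = measure N ((\<lambda>x. (f x, g x, h x)) -` {(a, b, c)})" for a b c
  have p_alt: "p a b c = measure N (f -` {a} \<inter> g -` {b} \<inter> h -` {c})" for a b c
    unfolding p_def by (rule arg_cong[where f="measure N"]) auto
  have split: "measure N S = (\<Sum>i\<in>range u. measure N (S \<inter> u -` {i}))"
    if "S \<in> sets N" "simple_function N u" for S and u :: "'x \<Rightarrow> 'z"
  proof -
    have "measure N S = measure N (\<Union>i\<in>range u. S \<inter> u -` {i})"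
      by (rule arg_cong[where f="measure N"]) auto
    also have "\<dots> = (\<Sum>i\<in>range u. measure N (S \<inter> u -` {i}))"
      using that by (intro finite_measure_finite_Union range_finite)
        (auto simp: disjoint_family_on_def fibre_sets intro!: sets.Int)
    finally show ?thesis .
  qed
  note ms = fibre_sets[OF f] fibre_sets[OF g] fibre_sets[OF h]
  have m1: "measure N ((\<lambda>x. (f x, h x)) -` {(a, c)}) = (\<Sum>b\<in>?B. p a b c)" for a c
  proof -
    have "(\<lambda>x. (f x, h x)) -` {(a, c)} = f -` {a} \<inter> h -` {c}" by auto
    then show ?thesis
      using split[OF sets.Int[OF ms(1) ms(3)] g, of "{a}" "{c}"] by (simp add: p_alt Int_ac)
  qed
  have m2: "measure N ((\<lambda>x. (g x, h x)) -` {(b, c)}) = (\<Sum>a\<in>?A. p a b c)" for b c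
  proof -
    have "(\<lambda>x. (g x, h x)) -` {(b, c)} = g -` {b} \<inter> h -` {c}" by auto
    then show ?thesis
      using split[OF sets.Int[OF ms(2) ms(3)] f, of "{b}" "{c}"] by (simp add: p_alt Int_ac)
  qed
  have m0: "measure N (h -` {c}) = (\<Sum>a\<in>?A. \<Sum>b\<in>?B. p a b c)" for c
  proof -
    have "measure N (h -` {c}) = (\<Sum>a\<in>?A. measure N (h -` {c} \<inter> f -` {a}))"
      by (rule split[OF ms(3) f])
    also have "\<dots> = (\<Sum>a\<in>?A. \<Sum>b\<in>?B. p a b c)"
      using split[OF sets.Int[OF ms(3) ms(1)] g, of "{c}"] by (simp add: p_alt Int_ac)
    finally show ?thesis .
  qed
  have "label_entropy N (\<lambda>x. (f x, g x, h x)) = (\<Sum>(a,b,c)\<in>?A \<times> ?B \<times> ?C. ?e (p a b c))"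
    using fin by (subst label_entropy_sum[of "?A \<times> ?B \<times> ?C"]) (auto simp: p_def intro!: sum.cong)
  also have "\<dots> = (\<Sum>a\<in>?A. \<Sum>b\<in>?B. \<Sum>c\<in>?C. ?e (p a b c))"
    by (simp add: sum.cartesian_product)
  also have "\<dots> = (\<Sum>a\<in>?A. \<Sum>c\<in>?C. \<Sum>b\<in>?B. ?e (p a b c))"
    by (intro sum.cong refl sum.swap)
  also have "\<dots> = (\<Sum>c\<in>?C. \<Sum>a\<in>?A. \<Sum>b\<in>?B. ?e (p a b c))"
    by (rule sum.swap)
  finally have e3: "label_entropy N (\<lambda>x. (f x, g x, h x)) = \<dots>" .
  have e0: "label_entropy N h = (\<Sum>c\<in>?C. ?e (\<Sum>a\<in>?A. \<Sum>b\<in>?B. p a b c))"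
    by (simp add: label_entropy_def m0)
  have "label_entropy N (\<lambda>x. (f x, h x)) = (\<Sum>(a,c)\<in>?A \<times> ?C. ?e (\<Sum>b\<in>?B. p a b c))"
    using fin by (subst label_entropy_sum[of "?A \<times> ?C"]) (auto simp: m1 intro!: sum.cong)
  also have "\<dots> = (\<Sum>a\<in>?A. \<Sum>c\<in>?C. ?e (\<Sum>b\<in>?B. p a b c))"
    by (simp add: sum.cartesian_product)
  also have "\<dots> = (\<Sum>c\<in>?C. \<Sum>a\<in>?A. ?e (\<Sum>b\<in>?B. p a b c))"
    by (rule sum.swap)
  finally have e1: "label_entropy N (\<lambda>x. (f x, h x)) = \<dots>" .
  have "label_entropy N (\<lambda>x. (g x, h x)) = (\<Sum>(b,c)\<in>?B \<times> ?C. ?e (\<Sum>a\<in>?A. p a b c))"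
    using fin by (subst label_entropy_sum[of "?B \<times> ?C"]) (auto simp: m2 intro!: sum.cong)
  also have "\<dots> = (\<Sum>b\<in>?B. \<Sum>c\<in>?C. ?e (\<Sum>a\<in>?A. p a b c))"
    by (simp add: sum.cartesian_product)
  also have "\<dots> = (\<Sum>c\<in>?C. \<Sum>b\<in>?B. ?e (\<Sum>a\<in>?A. p a b c))"
    by (rule sum.swap)
  finally have e2: "label_entropy N (\<lambda>x. (g x, h x)) = \<dots>" .
  have "(\<Sum>a\<in>?A. \<Sum>b\<in>?B. ?e (p a b c)) + ?e (\<Sum>a\<in>?A. \<Sum>b\<in>?B. p a b c)
     \<le> (\<Sum>a\<in>?A. ?e (\<Sum>b\<in>?B. p a b c)) + (\<Sum>b\<in>?B. ?e (\<Sum>a\<in>?A. p a b c))" for c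
    using entropy_matrix_le_marginals[OF fin(1,2), of "\<lambda>a b. p a b c"]
    by (simp add: p_def)
  then show ?thesis
    unfolding e3 e0 e1 e2 by (simp only: sum.distrib[symmetric]) (rule sum_mono)
qed

lemma label_entropy_mono:
  assumes "simple_function N f" "simple_function N g" "\<And>x y. f x = f y \<Longrightarrow> g x = g y"
  shows "label_entropy N g \<le> label_entropy N f"
proof -
  have "label_entropy N (\<lambda>x. (f x, f x, g x)) + label_entropy N g
    \<le> label_entropy N (\<lambda>x. (f x, g x)) + label_entropy N (\<lambda>x. (f x, g x))"
    by (rule label_entropy_submodular) fact+
  moreover have "label_entropy N (\<lambda>x. (f x, f x, g x)) = label_entropy N f"
    by (rule label_entropy_cong_inj) (use assms(3) in blast)
  moreover have "label_entropy N (\<lambda>x. (f x, g x)) = label_entropy N f"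
    by (rule label_entropy_cong_inj) (use assms(3) in blast)
  ultimately show ?thesis by simp
qed

lemma label_entropy_subadditive:
  assumes "simple_function N f" "simple_function N g"
  shows "label_entropy N (\<lambda>x. (f x, g x)) \<le> label_entropy N f + label_entropy N g"
proof -
  have "label_entropy N (\<lambda>x. (f x, g x, ())) + label_entropy N (\<lambda>x. ())
    \<le> label_entropy N (\<lambda>x. (f x, ())) + label_entropy N (\<lambda>x. (g x, ()))"
    by (rule label_entropy_submodular) (use assms in auto)
  moreover have "label_entropy N (\<lambda>x. (f x, g x, ())) = label_entropy N (\<lambda>x. (f x, g x))"
    "label_entropy N (\<lambda>x. (f x, ())) = label_entropy N f"
    "label_entropy N (\<lambda>x. (g x, ())) = label_entropy N g"
    by (auto intro: label_entropy_cong_inj)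
  ultimately show ?thesis by (simp add: label_entropy_const)
qed

end

section \<open>Shearer's inequality and limits along Folner sequences\<close>

text \<open>Adding a point \<open>a\<close> to \<open>F\<close> raises \<open>v F\<close> by at most the amount by which it raises \<open>v\<close> on each piece
  \<open>F \<inter> K c\<close> with \<open>a \<in> K c\<close>, by submodularity; at least \<open>k\<close> pieces contain \<open>a\<close>.\<close>

lemma shearer_submodular:
  fixes v :: "'a set \<Rightarrow> real" and K :: "'c \<Rightarrow> 'a set"
  assumes empty: "v {} = 0"
    and mono: "\<And>A B. B \<subseteq> E \<Longrightarrow> finite B \<Longrightarrow> A \<subseteq> B \<Longrightarrow> v A \<le> v B"
    and submodular: "\<And>A B. A \<subseteq> E \<Longrightarrow> B \<subseteq> E \<Longrightarrow> finite A \<Longrightarrow> finite B \<Longrightarrow>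
      v (A \<union> B) + v (A \<inter> B) \<le> v A + v B"
    and "finite C" and F: "finite F" "F \<subseteq> E"
    and cover: "\<And>a. a \<in> F \<Longrightarrow> k \<le> card {c \<in> C. a \<in> K c}"
  shows "real k * v F \<le> (\<Sum>c\<in>C. v (F \<inter> K c))"
  using F cover
proof (induction F)
  case empty
  then show ?case using assms(1) by simp
next
  case (insert a F)
  let ?d = "v (insert a F) - v F"
  have d: "0 \<le> ?d" using insert mono[of "insert a F" F] by auto
  have step: "(if a \<in> K c then ?d else 0) \<le> v (insert a F \<inter> K c) - v (F \<inter> K c)" for c
  proof (cases "a \<in> K c")
    case True
    have "v (F \<union> (insert a F \<inter> K c)) + v (F \<inter> (insert a F \<inter> K c)) \<le> v F + v (insert a F \<inter> K c)"
      using insert by (intro submodular) auto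
    moreover have "F \<union> (insert a F \<inter> K c) = insert a F" "F \<inter> (insert a F \<inter> K c) = F \<inter> K c"
      using True by auto
    ultimately show ?thesis using True by simp
  next
    case False
    then have "insert a F \<inter> K c = F \<inter> K c" by auto
    then show ?thesis using False by simp
  qed
  have "real k * ?d \<le> real (card {c \<in> C. a \<in> K c}) * ?d"
    using insert.prems d by (intro mult_right_mono) auto
  also have "\<dots> = (\<Sum>c\<in>C. if a \<in> K c then ?d else 0)"
    by (simp flip: sum.inter_filter[OF \<open>finite C\<close>])
  also have "\<dots> \<le> (\<Sum>c\<in>C. v (insert a F \<inter> K c) - v (F \<inter> K c))"
    by (intro sum_mono step)
  finally have "real k * ?d \<le> (\<Sum>c\<in>C. v (insert a F \<inter> K c)) - (\<Sum>c\<in>C. v (F \<inter> K c))"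
    by (simp add: sum_subtractf)
  moreover have "real k * v F \<le> (\<Sum>c\<in>C. v (F \<inter> K c))" using insert by auto
  ultimately show ?case by (simp add: algebra_simps)
qed

text \<open>The translates \<open>K #> c\<close> for \<open>c\<close> in \<open>K\<inverse>F\<close> cover each point of \<open>F\<close> at least \<open>card K\<close> times.
  If \<open>K #> c\<close> is not contained in \<open>F\<close>, then \<open>c\<close> lies in the boundary from the definition of a Folner
  sequence, so there are at most \<open>(1 + \<delta>) card F\<close> translates in all, and each contributes at most
  \<open>v K\<close> by invariance.\<close>

lemma (in group) Folner_limit_INF:
  fixes v :: "'a set \<Rightarrow> real"
  assumes F: "Folner_sequence G F"
    and empty: "v {} = 0"
    and mono: "\<And>A B. B \<subseteq> carrier G \<Longrightarrow> finite B \<Longrightarrow> A \<subseteq> B \<Longrightarrow> v A \<le> v B"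
    and submodular: "\<And>A B. A \<subseteq> carrier G \<Longrightarrow> B \<subseteq> carrier G \<Longrightarrow> finite A \<Longrightarrow> finite B \<Longrightarrow>
      v (A \<union> B) + v (A \<inter> B) \<le> v A + v B"
    and invariant: "\<And>K c. K \<subseteq> carrier G \<Longrightarrow> finite K \<Longrightarrow> c \<in> carrier G \<Longrightarrow> v (K #> c) = v K"
  shows "(\<lambda>n. v (F n) / real (card (F n)))
    \<longlonglongrightarrow> (INF K\<in>{K. finite K \<and> K \<noteq> {} \<and> K \<subseteq> carrier G}. v K / real (card K))"
    (is "?r \<longlonglongrightarrow> (INF K\<in>?S. _)")
proof (rule order_tendstoI)
  have Fn: "finite (F n)" "F n \<noteq> {}" "F n \<subseteq> carrier G" for n
    using F by (auto simp: Folner_sequence_def)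
  have nn: "0 \<le> v K" if "finite K" "K \<subseteq> carrier G" for K
    using mono[of K "{}"] that empty by simp
  have bdd: "bdd_below ((\<lambda>K. v K / real (card K)) ` ?S)"
    by (rule bdd_belowI[of _ 0]) (auto intro!: divide_nonneg_nonneg nn)
  {
    fix a assume "a < (INF K\<in>?S. v K / real (card K))"
    moreover have "(INF K\<in>?S. v K / real (card K)) \<le> ?r n" for n
      using Fn by (intro cINF_lower[OF bdd]) auto
    ultimately show "\<forall>\<^sub>F n in sequentially. a < ?r n"
      by (intro always_eventually allI) (rule less_le_trans)
  }
  fix a assume "(INF K\<in>?S. v K / real (card K)) < a"
  moreover have "?S \<noteq> {}" using one_closed by (auto intro!: exI[of _ "{\<one>}"])
  ultimately obtain K where K: "finite K" "K \<noteq> {}" "K \<subseteq> carrier G" and Ka: "v K / real (card K) < a"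
    using cINF_less_iff[OF _ bdd] by auto
  define r where "r = v K / real (card K)"
  \<comment> \<open>This gives \<open>(1 + \<delta>) r < a\<close>; the denominator is \<open>r + 1\<close> rather than \<open>r\<close> because \<open>r\<close> may be 0.\<close>
  define \<delta> where "\<delta> = (a - r) / (r + 1)"
  have r: "0 \<le> r" "r < a" using Ka K nn by (auto simp: r_def)
  have \<delta>: "0 < \<delta>" "\<delta> * r < a - r"
    using r by (auto simp: \<delta>_def field_simps)
  let ?C = "\<lambda>n. set_inv K <#> F n"
  let ?B = "\<lambda>n. ?C n \<inter> (set_inv K <#> (carrier G - F n))"
  have "\<forall>\<^sub>F n in sequentially. real (card (?B n)) < \<delta> * real (card (F n))"
    using F K \<delta>(1) unfolding Folner_sequence_def by blast
  then show "\<forall>\<^sub>F n in sequentially. ?r n < a"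
  proof eventually_elim
    case (elim n)
    have C_carrier: "?C n \<subseteq> carrier G" and C_fin: "finite (?C n)"
      using K Fn[of n] by (auto simp: set_mult_def SET_INV_def)
    have count: "card K \<le> card {c \<in> ?C n. x \<in> K #> c}" if x: "x \<in> F n" for x
    proof (rule card_inj_on_le[of "\<lambda>k. inv k \<otimes> x"])
      have xG: "x \<in> carrier G" using x Fn by auto
      show "inj_on (\<lambda>k. inv k \<otimes> x) K"
      proof (rule inj_onI)
        fix k k' assume "k \<in> K" "k' \<in> K" and eq: "inv k \<otimes> x = inv k' \<otimes> x"
        then have kG: "k \<in> carrier G" "k' \<in> carrier G" using K by auto
        then have "inv k = inv k'" using eq xG by simp
        then have "inv (inv k) = inv (inv k')" by simp
        then show "k = k'" using kG by simp
      qed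
      show "(\<lambda>k. inv k \<otimes> x) ` K \<subseteq> {c \<in> ?C n. x \<in> K #> c}"
      proof safe
        fix k assume k: "k \<in> K"
        then have kG: "k \<in> carrier G" using K by auto
        show "inv k \<otimes> x \<in> ?C n" using k x by (auto simp: set_mult_def SET_INV_def)
        have "x = k \<otimes> (inv k \<otimes> x)" using kG xG by (simp add: m_assoc[symmetric])
        then show "x \<in> K #> inv k \<otimes> x" using k by (auto simp: r_coset_def)
      qed
      show "finite {c \<in> ?C n. x \<in> K #> c}" using C_fin by simp
    qed
    have inside: "K #> c \<subseteq> F n" if c: "c \<in> ?C n - ?B n" for c
    proof
      fix y assume "y \<in> K #> c"
      then obtain k where k: "k \<in> K" "y = k \<otimes> c" by (auto simp: r_coset_def)
      have cG: "c \<in> carrier G" and kG: "k \<in> carrier G" using c C_carrier k K by auto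
      show "y \<in> F n"
      proof (rule ccontr)
        assume "y \<notin> F n"
        then have "inv k \<otimes> y \<in> set_inv K <#> (carrier G - F n)"
          using k cG kG by (auto simp: set_mult_def SET_INV_def)
        moreover have "inv k \<otimes> y = c" using k cG kG by (simp add: m_assoc[symmetric])
        ultimately show False using c by auto
      qed
    qed
    obtain k0 where k0: "k0 \<in> K" using K by auto
    have "card (?C n - ?B n) \<le> card (F n)"
    proof (rule card_inj_on_le[of "\<lambda>c. k0 \<otimes> c"])
      show "inj_on (\<lambda>c. k0 \<otimes> c) (?C n - ?B n)"
        using C_carrier k0 K by (intro inj_onI) (auto simp: subset_eq)
      show "(\<lambda>c. k0 \<otimes> c) ` (?C n - ?B n) \<subseteq> F n"
        using inside k0 by (auto simp: r_coset_def)
    qed (rule Fn)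
    moreover have "card (?C n) = card (?C n - ?B n) + card (?B n)"
    proof -
      have "?C n = (?C n - ?B n) \<union> ?B n" by auto
      moreover have "card ((?C n - ?B n) \<union> ?B n) = card (?C n - ?B n) + card (?B n)"
        using C_fin by (intro card_Un_disjoint) auto
      ultimately show ?thesis by metis
    qed
    ultimately have card_C: "real (card (?C n)) \<le> (1 + \<delta>) * real (card (F n))"
      using elim by (simp add: algebra_simps)
    have "real (card K) * v (F n) \<le> (\<Sum>c\<in>?C n. v (F n \<inter> (K #> c)))"
      using Fn count C_fin
      by (intro shearer_submodular[where E="carrier G", OF empty mono submodular]) auto
    also have "\<dots> \<le> (\<Sum>c\<in>?C n. v K)"
    proof (rule sum_mono)
      fix c assume "c \<in> ?C n"
      then have c: "c \<in> carrier G" using C_carrier by auto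
      have "v (F n \<inter> (K #> c)) \<le> v (K #> c)"
        using K c r_coset_subset_G[of K c] by (intro mono) (auto simp: r_coset_def)
      then show "v (F n \<inter> (K #> c)) \<le> v K" using invariant K c by simp
    qed
    also have "\<dots> \<le> (1 + \<delta>) * real (card (F n)) * v K"
      using mult_right_mono[OF card_C nn[OF K(1,3)]] by simp
    finally have "v (F n) / real (card (F n)) \<le> (1 + \<delta>) * r"
      using K Fn[of n] by (simp add: r_def field_simps card_gt_0_iff)
    also have "\<dots> < a" using \<delta> by (simp add: algebra_simps)
    finally show ?case .
  qed
qed

section \<open>Entropy rate of an observable\<close>

definition itinerary :: "('g \<Rightarrow> 'x \<Rightarrow> 'x) \<Rightarrow> 'g set \<Rightarrow> ('x \<Rightarrow> 'l) \<Rightarrow> 'x \<Rightarrow> 'g \<Rightarrow> 'l" where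
  "itinerary \<phi> K f x = (\<lambda>g\<in>K. f (\<phi> g x))"

lemma itinerary_eq_iff:
  "itinerary \<phi> K f x = itinerary \<phi> K f y \<longleftrightarrow> (\<forall>g\<in>K. f (\<phi> g x) = f (\<phi> g y))"
  by (auto simp: itinerary_def fun_eq_iff)

text \<open>Only the measurable structure enters, so that \<open>N\<close> can later be the completion of an invariant Borel
  measure: Pinsker sets are taken in the completed \<open>\<sigma>\<close>-algebra.\<close>

locale amenable_pmp_action = group G + full_prob_space N
  for G :: "('g, 'b) monoid_scheme" (structure) and N :: "'x measure" +
  fixes \<phi> :: "'g \<Rightarrow> 'x \<Rightarrow> 'x"
  assumes act_measurable: "g \<in> carrier G \<Longrightarrow> \<phi> g \<in> N \<rightarrow>\<^sub>M N"
    and act_distr: "g \<in> carrier G \<Longrightarrow> distr N N (\<phi> g) = N"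
    and act_mult: "g \<in> carrier G \<Longrightarrow> h \<in> carrier G \<Longrightarrow> \<phi> (g \<otimes> h) x = \<phi> g (\<phi> h x)"
    and act_one: "\<phi> \<one> x = x"
    and amenable: "amenable G"
begin

lemma simple_itinerary:
  assumes K: "finite K" "K \<subseteq> carrier G" and f: "simple_function N f"
  shows "simple_function N (itinerary \<phi> K f)"
proof -
  have "range (itinerary \<phi> K f) \<subseteq> K \<rightarrow>\<^sub>E range f" by (auto simp: itinerary_def)
  moreover have "finite (K \<rightarrow>\<^sub>E range f)" using K range_finite[OF f] by (intro finite_PiE)
  ultimately have "finite (range (itinerary \<phi> K f))" by (rule finite_subset)
  moreover have "itinerary \<phi> K f -` {itinerary \<phi> K f x} \<in> sets N" for x
  proof -
    have "itinerary \<phi> K f -` {itinerary \<phi> K f x} = space N \<inter> (\<Inter>g\<in>K. \<phi> g -` (f -` {f (\<phi> g x)}))"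
      by (auto simp: itinerary_eq_iff)
    also have "\<dots> \<in> sets N"
    proof (cases "K = {}")
      case False
      have "\<phi> g -` (f -` {f (\<phi> g x)}) \<in> sets N" if "g \<in> K" for g
        using measurable_sets[OF act_measurable fibre_sets[OF f], of g "{f (\<phi> g x)}"] that K by auto
      then have "(\<Inter>g\<in>K. \<phi> g -` (f -` {f (\<phi> g x)})) \<in> sets N"
        using False K by (intro sets.finite_INT)
      then show ?thesis by simp
    qed simp
    finally show ?thesis .
  qed
  ultimately show ?thesis unfolding simple_function_def space_full Int_UNIV_right by blast
qed

lemma measure_act_vimage:
  assumes "g \<in> carrier G" "A \<in> sets N"
  shows "measure N (\<phi> g -` A) = measure N A"
  using measure_distr[OF act_measurable assms(2), of g] assms act_distr by simp

lemma label_entropy_act: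
  assumes "g \<in> carrier G" "simple_function N f"
  shows "label_entropy N (\<lambda>x. f (\<phi> g x)) = label_entropy N f"
proof -
  have "(\<lambda>x. f (\<phi> g x)) -` {a} = \<phi> g -` (f -` {a})" for a by auto
  then have "measure N ((\<lambda>x. f (\<phi> g x)) -` {a}) = measure N (f -` {a})" for a
    using measure_act_vimage[OF assms(1) fibre_sets[OF assms(2)]] by simp
  moreover have "range (\<lambda>x. f (\<phi> g x)) \<subseteq> range f" by auto
  ultimately show ?thesis
    by (subst label_entropy_sum[OF range_finite[OF assms(2)]]) (simp_all add: label_entropy_def)
qed

text \<open>The infimum makes sense without reference to Folner sequences and shows at once that the entropy
  rate is at most the entropy (take \<open>K = {\<one>}\<close>).\<close>

definition entropy_rate :: "('x \<Rightarrow> 'l) \<Rightarrow> real" where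
  "entropy_rate f = (INF K\<in>{K. finite K \<and> K \<noteq> {} \<and> K \<subseteq> carrier G}.
     label_entropy N (itinerary \<phi> K f) / real (card K))"

lemma entropy_rate_limit:
  assumes f: "simple_function N f" and F: "Folner_sequence G F"
  shows "(\<lambda>n. label_entropy N (itinerary \<phi> (F n) f) / real (card (F n))) \<longlonglongrightarrow> entropy_rate f"
  unfolding entropy_rate_def
proof (rule Folner_limit_INF[OF F])
  have "itinerary \<phi> {} f = (\<lambda>_ _. undefined)" by (intro ext) (simp add: itinerary_def)
  then show "label_entropy N (itinerary \<phi> {} f) = 0" by (simp add: label_entropy_const)
next
  fix A B assume "B \<subseteq> carrier G" "finite B" "A \<subseteq> B"
  then show "label_entropy N (itinerary \<phi> A f) \<le> label_entropy N (itinerary \<phi> B f)"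
    using f by (intro label_entropy_mono simple_itinerary)
      (auto simp: itinerary_eq_iff intro: finite_subset)
next
  fix A B assume AB: "A \<subseteq> carrier G" "B \<subseteq> carrier G" "finite A" "finite B"
  have "label_entropy N (\<lambda>x. (itinerary \<phi> A f x, itinerary \<phi> B f x, itinerary \<phi> (A \<inter> B) f x))
      + label_entropy N (itinerary \<phi> (A \<inter> B) f)
    \<le> label_entropy N (\<lambda>x. (itinerary \<phi> A f x, itinerary \<phi> (A \<inter> B) f x))
      + label_entropy N (\<lambda>x. (itinerary \<phi> B f x, itinerary \<phi> (A \<inter> B) f x))"
    using f AB by (intro label_entropy_submodular simple_itinerary) auto
  moreover have "label_entropy N (\<lambda>x. (itinerary \<phi> A f x, itinerary \<phi> B f x, itinerary \<phi> (A \<inter> B) f x))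
      = label_entropy N (itinerary \<phi> (A \<union> B) f)"
    "label_entropy N (\<lambda>x. (itinerary \<phi> A f x, itinerary \<phi> (A \<inter> B) f x))
      = label_entropy N (itinerary \<phi> A f)"
    "label_entropy N (\<lambda>x. (itinerary \<phi> B f x, itinerary \<phi> (A \<inter> B) f x))
      = label_entropy N (itinerary \<phi> B f)"
    by (intro label_entropy_cong_inj; auto simp: itinerary_eq_iff)+
  ultimately show "label_entropy N (itinerary \<phi> (A \<union> B) f) + label_entropy N (itinerary \<phi> (A \<inter> B) f)
    \<le> label_entropy N (itinerary \<phi> A f) + label_entropy N (itinerary \<phi> B f)" by simp
next
  fix K c assume K: "K \<subseteq> carrier G" "finite K" and c: "c \<in> carrier G"
  have "f (\<phi> (k \<otimes> c) x) = f (\<phi> k (\<phi> c x))" if "k \<in> K" for k x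
    using act_mult that K c by auto
  then have "label_entropy N (itinerary \<phi> (K #> c) f) = label_entropy N (\<lambda>x. itinerary \<phi> K f (\<phi> c x))"
    by (intro label_entropy_cong_inj) (auto simp: itinerary_eq_iff r_coset_def)
  also have "\<dots> = label_entropy N (itinerary \<phi> K f)"
    by (rule label_entropy_act[OF c simple_itinerary[OF K(2,1) f]])
  finally show "label_entropy N (itinerary \<phi> (K #> c) f) = label_entropy N (itinerary \<phi> K f)" .
qed

lemma Folner_exists:
  "\<exists>F. Folner_sequence G F \<and> (\<forall>n. finite (F n)) \<and> (\<forall>n. F n \<subseteq> carrier G)"
  using amenable by (auto simp: amenable_def Folner_sequence_def)

lemma entropy_rate_nonneg:
  assumes "simple_function N f" shows "0 \<le> entropy_rate f"
proof -
  obtain F where "Folner_sequence G F" using Folner_exists by blast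
  from entropy_rate_limit[OF assms this] show ?thesis
    by (rule LIMSEQ_le_const) (auto intro!: divide_nonneg_nonneg label_entropy_nonneg)
qed

lemma entropy_rate_le_label_entropy:
  assumes "simple_function N f" shows "entropy_rate f \<le> label_entropy N f"
proof -
  have "bdd_below ((\<lambda>K. label_entropy N (itinerary \<phi> K f) / real (card K))
    ` {K. finite K \<and> K \<noteq> {} \<and> K \<subseteq> carrier G})"
    by (rule bdd_belowI[of _ 0]) (auto intro!: divide_nonneg_nonneg label_entropy_nonneg)
  then have "entropy_rate f \<le> label_entropy N (itinerary \<phi> {\<one>} f) / real (card {\<one>})"
    unfolding entropy_rate_def by (rule cINF_lower) auto
  also have "label_entropy N (itinerary \<phi> {\<one>} f) = label_entropy N f"
    by (rule label_entropy_cong_inj) (simp add: itinerary_eq_iff act_one)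
  finally show ?thesis by simp
qed

lemma entropy_rate_mono:
  assumes f: "simple_function N f" and g: "simple_function N g"
    and fg: "\<And>x y. f x = f y \<Longrightarrow> g x = g y"
  shows "entropy_rate g \<le> entropy_rate f"
proof -
  obtain F where F: "Folner_sequence G F" "\<And>n. finite (F n)" "\<And>n. F n \<subseteq> carrier G"
    using Folner_exists by blast
  show ?thesis
  proof (rule LIMSEQ_le[OF entropy_rate_limit[OF g F(1)] entropy_rate_limit[OF f F(1)]])
    have "label_entropy N (itinerary \<phi> (F n) g) \<le> label_entropy N (itinerary \<phi> (F n) f)" for n
      using F f g by (intro label_entropy_mono simple_itinerary) (auto simp: itinerary_eq_iff intro: fg)
    then show "\<exists>M. \<forall>n\<ge>M. label_entropy N (itinerary \<phi> (F n) g) / real (card (F n))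
        \<le> label_entropy N (itinerary \<phi> (F n) f) / real (card (F n))"
      by (auto intro!: divide_right_mono)
  qed
qed

lemma entropy_rate_subadditive:
  assumes f: "simple_function N f" and g: "simple_function N g"
  shows "entropy_rate (\<lambda>x. (f x, g x)) \<le> entropy_rate f + entropy_rate g"
proof -
  obtain F where F: "Folner_sequence G F" "\<And>n. finite (F n)" "\<And>n. F n \<subseteq> carrier G"
    using Folner_exists by blast
  let ?fg = "\<lambda>x. (f x, g x)"
  have fg: "simple_function N ?fg" using f g by simp
  show ?thesis
  proof (rule LIMSEQ_le[OF entropy_rate_limit[OF fg F(1)]
        tendsto_add[OF entropy_rate_limit[OF f F(1)] entropy_rate_limit[OF g F(1)]]])
    have "label_entropy N (itinerary \<phi> (F n) ?fg)
        = label_entropy N (\<lambda>x. (itinerary \<phi> (F n) f x, itinerary \<phi> (F n) g x))" for n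
      by (rule label_entropy_cong_inj) (auto simp: itinerary_eq_iff)
    moreover have "label_entropy N (\<lambda>x. (itinerary \<phi> (F n) f x, itinerary \<phi> (F n) g x))
        \<le> label_entropy N (itinerary \<phi> (F n) f) + label_entropy N (itinerary \<phi> (F n) g)" for n
      using F f g by (intro label_entropy_subadditive simple_itinerary) auto
    ultimately show "\<exists>M. \<forall>n\<ge>M. label_entropy N (itinerary \<phi> (F n) ?fg) / real (card (F n))
        \<le> label_entropy N (itinerary \<phi> (F n) f) / real (card (F n))
          + label_entropy N (itinerary \<phi> (F n) g) / real (card (F n))"
      by (auto simp flip: add_divide_distrib intro!: divide_right_mono)
  qed
qed

lemma label_entropy_eq_sum_cells:
  assumes "finite \<beta>" "(\<lambda>a. f -` {a}) ` range f = \<beta> - {{}}"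
  shows "label_entropy N f = (\<Sum>A\<in>\<beta>. - measure N A * ln (measure N A))"
proof -
  have "(\<Sum>A\<in>\<beta>. - measure N A * ln (measure N A)) = (\<Sum>A\<in>\<beta> - {{}}. - measure N A * ln (measure N A))"
    using assms(1) by (intro sum.mono_neutral_right) auto
  also have "\<dots> = label_entropy N f"
    unfolding assms(2)[symmetric] label_entropy_def
    by (subst sum.reindex) (auto simp: inj_on_def)
  finally show ?thesis by simp
qed

text \<open>The join may contain the empty set, and so may the partition \<open>{A, - A}\<close>; apart from it, the cells are
  precisely the fibres of the itinerary.\<close>

lemma itinerary_cells:
  assumes "(\<lambda>a. f -` {a}) ` range f = \<alpha> - {{}}"
  shows "(\<lambda>a. itinerary \<phi> K f -` {a}) ` range (itinerary \<phi> K f) = dynamical_join \<phi> K \<alpha> - {{}}"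
proof -
  have cell: "itinerary \<phi> K f -` {itinerary \<phi> K f x} = (\<Inter>g\<in>K. \<phi> g -` (f -` {f (\<phi> g x)}))" for x
    by (auto simp: itinerary_eq_iff)
  have fa: "f -` {f y} \<in> \<alpha>" for y using assms by blast
  show ?thesis
  proof (intro subset_antisym subsetI)
    fix S assume "S \<in> (\<lambda>a. itinerary \<phi> K f -` {a}) ` range (itinerary \<phi> K f)"
    then obtain x where S: "S = itinerary \<phi> K f -` {itinerary \<phi> K f x}" by blast
    have "S \<in> dynamical_join \<phi> K \<alpha>"
      unfolding dynamical_join_def S cell using fa
      by (intro image_eqI[of _ _ "\<lambda>g\<in>K. f -` {f (\<phi> g x)}"]) auto
    moreover have "x \<in> S" by (simp add: S)
    ultimately show "S \<in> dynamical_join \<phi> K \<alpha> - {{}}" by blast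
  next
    fix S assume "S \<in> dynamical_join \<phi> K \<alpha> - {{}}"
    then obtain x where "S \<in> dynamical_join \<phi> K \<alpha>" and x: "x \<in> S" by blast
    then obtain c where c: "c \<in> K \<rightarrow>\<^sub>E \<alpha>" and S: "S = (\<Inter>g\<in>K. \<phi> g -` c g)"
      by (auto simp: dynamical_join_def)
    have "c g = f -` {f (\<phi> g x)}" if g: "g \<in> K" for g
    proof -
      have "c g \<in> \<alpha> - {{}}" "\<phi> g x \<in> c g" using c g x S by auto
      then obtain a where "c g = f -` {a}" using assms by blast
      then show ?thesis using \<open>\<phi> g x \<in> c g\<close> by auto
    qed
    then have "S = itinerary \<phi> K f -` {itinerary \<phi> K f x}" unfolding S cell by auto
    then show "S \<in> (\<lambda>a. itinerary \<phi> K f -` {a}) ` range (itinerary \<phi> K f)" by blast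
  qed
qed

lemma entropy_of_partition_eq_rate:
  assumes N: "N = completion \<mu>" and fin: "finite \<alpha>" and f: "simple_function N f"
    and cells: "(\<lambda>a. f -` {a}) ` range f = \<alpha> - {{}}"
  shows "entropy_of_partition G \<phi> \<mu> \<alpha> = entropy_rate f"
proof -
  have eq: "partition_entropy \<mu> (dynamical_join \<phi> K \<alpha>) = label_entropy N (itinerary \<phi> K f)"
    if "finite K" for K
    unfolding partition_entropy_def N[symmetric]
    by (rule label_entropy_eq_sum_cells[symmetric, OF _ itinerary_cells[OF cells]])
       (auto simp: dynamical_join_def fin that intro!: finite_PiE)
  have lim: "(\<lambda>m. partition_entropy \<mu> (dynamical_join \<phi> (F m) \<alpha>) / real (card (F m)))
      \<longlonglongrightarrow> entropy_rate f" if F: "Folner_sequence G F" for F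
  proof -
    have "finite (F m)" for m using F by (simp add: Folner_sequence_def)
    then show ?thesis using entropy_rate_limit[OF f F] by (simp add: eq)
  qed
  obtain F where F: "Folner_sequence G F" using Folner_exists by blast
  show ?thesis unfolding entropy_of_partition_def
    using lim F by (intro the_equality) (auto intro: LIMSEQ_unique)
qed

section \<open>Pinsker sets\<close>

lemma simple_indicator: "A \<in> sets N \<Longrightarrow> simple_function N (\<lambda>x. x \<in> A)"
proof -
  assume A: "A \<in> sets N"
  then have "- A \<in> sets N" by (rule Compl_sets)
  moreover have "(\<lambda>x. x \<in> A) -` {b} = (if b then A else - A)" for b by auto
  ultimately show ?thesis using A by (auto simp: simple_function_def)
qed

definition zero_entropy_sets :: "'x set set" where
  "zero_entropy_sets = {A \<in> sets N. entropy_rate (\<lambda>x. x \<in> A) = 0}"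

lemma Pinsker_sets_eq:
  assumes N: "N = completion \<mu>"
  shows "Pinsker_sets G \<phi> \<mu> = zero_entropy_sets"
proof -
  have "entropy_of_partition G \<phi> \<mu> {A, - A} = entropy_rate (\<lambda>x. x \<in> A)" if "A \<in> sets N" for A
  proof (rule entropy_of_partition_eq_rate[OF N _ simple_indicator[OF that]])
    have cell: "(\<lambda>x. x \<in> A) -` {x \<in> A} = (if x \<in> A then A else - A)" for x by auto
    show "(\<lambda>b. (\<lambda>x. x \<in> A) -` {b}) ` range (\<lambda>x. x \<in> A) = {A, - A} - {{}}"
      unfolding image_image cell by (auto simp: image_iff)
  qed auto
  then show ?thesis by (auto simp: Pinsker_sets_def zero_entropy_sets_def N[symmetric])
qed

text \<open>A concrete bound that tends to 0 with the measure of \<open>A\<close>, which is what countable unions of Pinsker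
  sets require. The square root comes from \<open>- ln m = 2 ln (1 / sqrt m) \<le> 2 / sqrt m\<close>.\<close>

lemma label_entropy_indicator_le:
  assumes A: "A \<in> sets N"
  shows "label_entropy N (\<lambda>x. x \<in> A) \<le> 2 * sqrt (measure N A) + measure N A"
proof -
  let ?m = "measure N A"
  have m: "0 \<le> ?m" "?m \<le> 1" by auto
  have 1: "- ?m * ln ?m \<le> 2 * sqrt ?m"
  proof (cases "?m = 0")
    case False
    then have pos: "0 < ?m" using m by linarith
    have "- ln ?m = 2 * ln (1 / sqrt ?m)" using pos by (simp add: ln_div ln_sqrt)
    also have "\<dots> \<le> 2 * (1 / sqrt ?m)"
      using ln_le_minus_one[of "1 / sqrt ?m"] pos by (simp del: measure_le_0_iff)
    finally have "?m * (- ln ?m) \<le> ?m * (2 * (1 / sqrt ?m))" using m by (intro mult_left_mono)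
    also have "\<dots> = 2 * sqrt ?m" using pos by (simp add: field_simps)
    finally show ?thesis by simp
  qed simp
  have 2: "- (1 - ?m) * ln (1 - ?m) \<le> ?m"
  proof (cases "?m = 1")
    case False
    then have pos: "0 < 1 - ?m" using m by linarith
    have "- ln (1 - ?m) = ln (1 / (1 - ?m))" using pos by (simp add: ln_div)
    also have "\<dots> \<le> 1 / (1 - ?m) - 1" using pos by (intro ln_le_minus_one) simp
    finally have "(1 - ?m) * (- ln (1 - ?m)) \<le> (1 - ?m) * (1 / (1 - ?m) - 1)"
      using pos by (intro mult_left_mono) auto
    also have "\<dots> = ?m" using pos by (simp add: field_simps)
    finally show ?thesis by (simp add: algebra_simps)
  qed (use m in simp)
  have cells: "(\<lambda>x. x \<in> A) -` {True} = A" "(\<lambda>x. x \<in> A) -` {False} = UNIV - A" by auto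
  have compl: "measure N (UNIV - A) = 1 - ?m" using prob_compl[OF A] by simp
  have fin: "finite {True, False}" "range (\<lambda>x. x \<in> A) \<subseteq> {True, False}" by auto
  have sum_bool: "(\<Sum>b\<in>{True, False}. h b) = h True + h False" for h :: "bool \<Rightarrow> real" by simp
  have "label_entropy N (\<lambda>x. x \<in> A) = - ?m * ln ?m + - (1 - ?m) * ln (1 - ?m)"
    unfolding label_entropy_sum[OF fin] sum_bool cells compl ..
  then show ?thesis using 1 2 by linarith
qed

lemma null_zero_entropy:
  assumes "A \<in> null_sets N" shows "A \<in> zero_entropy_sets"
proof -
  have A: "A \<in> sets N" "measure N A = 0" using assms by (auto simp: measure_eq_0_null_sets)
  have "entropy_rate (\<lambda>x. x \<in> A) \<le> 0"
    using entropy_rate_le_label_entropy[OF simple_indicator[OF A(1)]]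
      label_entropy_indicator_le[OF A(1)] A(2) by simp
  then show ?thesis
    using entropy_rate_nonneg[OF simple_indicator[OF A(1)]] A by (simp add: zero_entropy_sets_def)
qed

lemma zero_entropy_Compl:
  assumes "A \<in> zero_entropy_sets" shows "- A \<in> zero_entropy_sets"
proof -
  have A: "A \<in> sets N" and z: "entropy_rate (\<lambda>x. x \<in> A) = 0"
    using assms by (auto simp: zero_entropy_sets_def)
  have C: "- A \<in> sets N" using A by (rule Compl_sets)
  have "entropy_rate (\<lambda>x. x \<in> - A) \<le> entropy_rate (\<lambda>x. x \<in> A)"
    using A C by (intro entropy_rate_mono simple_indicator) auto
  then show ?thesis
    using entropy_rate_nonneg[OF simple_indicator[OF C]] z C by (simp add: zero_entropy_sets_def)
qed

lemma zero_entropy_Un: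
  assumes "A \<in> zero_entropy_sets" "B \<in> zero_entropy_sets"
  shows "A \<union> B \<in> zero_entropy_sets"
proof -
  have AB: "A \<in> sets N" "B \<in> sets N" "entropy_rate (\<lambda>x. x \<in> A) = 0" "entropy_rate (\<lambda>x. x \<in> B) = 0"
    using assms by (auto simp: zero_entropy_sets_def)
  have "entropy_rate (\<lambda>x. x \<in> A \<union> B) \<le> entropy_rate (\<lambda>x. (x \<in> A, x \<in> B))"
    using AB by (intro entropy_rate_mono simple_indicator simple_function_Pair) auto
  also have "\<dots> \<le> 0"
    using entropy_rate_subadditive[OF simple_indicator[OF AB(1)] simple_indicator[OF AB(2)]] AB by simp
  finally show ?thesis
    using entropy_rate_nonneg[OF simple_indicator, of "A \<union> B"] AB by (simp add: zero_entropy_sets_def)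
qed

text \<open>Let \<open>B\<^sub>k\<close> be the union of the first \<open>k\<close> sets. The indicator of the whole union \<open>U\<close> is determined by the
  indicators of \<open>B\<^sub>k\<close> and of \<open>U - B\<^sub>k\<close>; the former has rate 0 and the latter has entropy
  tending to 0.\<close>

lemma zero_entropy_UN:
  assumes A: "\<And>i::nat. A i \<in> zero_entropy_sets"
  shows "(\<Union>i. A i) \<in> zero_entropy_sets"
proof -
  let ?U = "\<Union>i. A i"
  define B where "B k = (\<Union>i<k. A i)" for k
  have B: "B k \<in> zero_entropy_sets" for k
    unfolding B_def
  proof (induction k)
    case 0
    then show ?case using null_zero_entropy[of "{}"] by simp
  next
    case (Suc k)
    then show ?case using zero_entropy_Un[OF A[of k]] by (simp add: lessThan_Suc)
  qed
  have sets: "A i \<in> sets N" "B k \<in> sets N" for i k using A B by (auto simp: zero_entropy_sets_def)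
  have U: "?U \<in> sets N" using sets by auto
  have D: "?U - B k \<in> sets N" for k using sets U by auto
  have bound: "entropy_rate (\<lambda>x. x \<in> ?U) \<le> 2 * sqrt (measure N (?U - B k)) + measure N (?U - B k)" for k
  proof -
    have "B k \<subseteq> ?U" by (auto simp: B_def)
    then have "entropy_rate (\<lambda>x. x \<in> ?U) \<le> entropy_rate (\<lambda>x. (x \<in> B k, x \<in> ?U - B k))"
      using U D sets by (intro entropy_rate_mono simple_indicator simple_function_Pair) auto
    also have "\<dots> \<le> entropy_rate (\<lambda>x. x \<in> B k) + entropy_rate (\<lambda>x. x \<in> ?U - B k)"
      using D sets by (intro entropy_rate_subadditive simple_indicator)
    also have "entropy_rate (\<lambda>x. x \<in> B k) = 0" using B by (simp add: zero_entropy_sets_def)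
    finally show ?thesis
      using entropy_rate_le_label_entropy[OF simple_indicator[OF D[of k]]]
        label_entropy_indicator_le[OF D[of k]] by linarith
  qed
  have "(\<lambda>k. measure N (?U - B k)) \<longlonglongrightarrow> measure N (\<Inter>k. ?U - B k)"
    using D by (intro finite_Lim_measure_decseq) (auto simp: decseq_def B_def)
  moreover have "(\<Inter>k. ?U - B k) = {}" unfolding B_def by blast
  ultimately have "(\<lambda>k. measure N (?U - B k)) \<longlonglongrightarrow> 0" by (simp only: measure_empty)
  then have "(\<lambda>k. 2 * sqrt (measure N (?U - B k)) + measure N (?U - B k)) \<longlonglongrightarrow> 2 * sqrt 0 + 0"
    by (intro tendsto_intros)
  then have "entropy_rate (\<lambda>x. x \<in> ?U) \<le> 2 * sqrt 0 + 0"
    by (rule LIMSEQ_le_const) (use bound in auto)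
  then show ?thesis
    using entropy_rate_nonneg[OF simple_indicator[OF U]] U by (simp add: zero_entropy_sets_def)
qed

lemma sigma_algebra_zero_entropy: "sigma_algebra UNIV zero_entropy_sets"
  unfolding sigma_algebra_iff2
  using null_zero_entropy[of "{}"] zero_entropy_Compl zero_entropy_UN
  by (auto simp: Compl_eq_Diff_UNIV range_subsetD)

text \<open>Reveal the values of \<open>f\<close> one at a time; each costs the entropy rate of one cell.\<close>

lemma entropy_rate_eq_0_if_cells:
  assumes f: "simple_function N f" and cells: "\<And>a. f -` {a} \<in> zero_entropy_sets"
  shows "entropy_rate f = 0"
proof -
  let ?r = "\<lambda>S x. if f x \<in> S then Some (f x) else None"
  have simple: "simple_function N (?r S)" for S
    using simple_function_compose[OF f, of "\<lambda>a. if a \<in> S then Some a else None"] by (simp add: comp_def)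
  have "entropy_rate (?r S) = 0" if "finite S" for S
    using that
  proof induction
    case empty
    have "entropy_rate (?r {}) \<le> label_entropy N (?r {})"
      by (rule entropy_rate_le_label_entropy[OF simple])
    then show ?case using entropy_rate_nonneg[OF simple, of "{}"] by (simp add: label_entropy_const)
  next
    case (insert a S)
    have ind: "simple_function N (\<lambda>x. x \<in> f -` {a})" by (intro simple_indicator fibre_sets f)
    have "entropy_rate (?r (insert a S)) \<le> entropy_rate (\<lambda>x. (?r S x, x \<in> f -` {a}))"
      by (intro entropy_rate_mono simple simple_function_Pair ind) (auto split: if_splits)
    also have "\<dots> \<le> entropy_rate (?r S) + entropy_rate (\<lambda>x. x \<in> f -` {a})"
      by (intro entropy_rate_subadditive simple ind)
    also have "\<dots> = 0" using insert.IH cells[of a] by (simp add: zero_entropy_sets_def)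
    finally show ?case using entropy_rate_nonneg[OF simple, of "insert a S"] by simp
  qed
  from this[OF range_finite[OF f]] have "entropy_rate (?r (range f)) = 0" .
  moreover have "entropy_rate f \<le> entropy_rate (?r (range f))"
    by (intro entropy_rate_mono f simple) auto
  ultimately show ?thesis using entropy_rate_nonneg[OF f] by simp
qed

end

section \<open>The relatively independent product of copies of a probability space\<close>

text \<open>The number \<open>weight A\<close> is the value that the relatively independent product over \<open>P\<close> is to take on the
  rectangle with sides \<open>A i\<close>, for \<open>i\<close> in the index set \<open>T\<close>. For \<open>T = {}\<close> the rectangles would not
  contain the empty set, hence would not form a semiring.\<close>

locale cond_exp_product = full_prob_space N for N :: "'x measure" +
  fixes P :: "'x measure" and T :: "nat set"
  assumes subalgebra: "subalgebra N P" and finite_T: "finite T" and T_nonempty: "T \<noteq> {}"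
begin

sublocale finite_measure_subalgebra N P
  by unfold_locales (rule subalgebra)

abbreviation ce :: "'x set \<Rightarrow> 'x \<Rightarrow> real" where
  "ce A \<equiv> real_cond_exp N P (indicat_real A)"

definition weight :: "(nat \<Rightarrow> 'x set) \<Rightarrow> real" where
  "weight A = (\<integral>x. (\<Prod>i\<in>T. ce (A i) x) \<partial>N)"

lemma integrable_indicat: "A \<in> sets N \<Longrightarrow> integrable N (indicat_real A)"
  by (simp add: integrable_indicator_iff emeasure_eq_measure)

lemma ce_nonneg: "A \<in> sets N \<Longrightarrow> AE x in N. 0 \<le> ce A x"
  by (rule real_cond_exp_pos) auto

lemma ce_le_1: "A \<in> sets N \<Longrightarrow> AE x in N. ce A x \<le> 1"
  by (rule real_cond_exp_le_c[OF integrable_indicat]) (auto simp: indicator_def)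

lemma ce_UNIV: "AE x in N. ce UNIV x = 1"
proof -
  have "AE x in N. ce UNIV x = indicat_real UNIV x"
    by (rule real_cond_exp_F_meas) (auto intro: integrable_indicat)
  then show ?thesis by simp
qed

lemma integral_ce: "A \<in> sets N \<Longrightarrow> (\<integral>x. ce A x \<partial>N) = measure N A"
  using real_cond_exp_int(2)[OF integrable_indicat, of A] by simp

lemma prod_ce_bounds:
  assumes "\<And>i. i \<in> T \<Longrightarrow> A i \<in> sets N"
  shows "AE x in N. 0 \<le> (\<Prod>i\<in>T. ce (A i) x) \<and> (\<Prod>i\<in>T. ce (A i) x) \<le> 1"
proof -
  have "AE x in N. \<forall>i\<in>T. 0 \<le> ce (A i) x \<and> ce (A i) x \<le> 1"
    using assms ce_nonneg ce_le_1 by (intro AE_finite_allI finite_T) auto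
  then show ?thesis
    by eventually_elim (auto intro!: prod_nonneg prod_le_1)
qed

lemma integrable_prod_ce:
  assumes "\<And>i. i \<in> T \<Longrightarrow> A i \<in> sets N"
  shows "integrable N (\<lambda>x. \<Prod>i\<in>T. ce (A i) x)"
proof (rule integrable_const_bound[where B=1])
  show "AE x in N. norm (\<Prod>i\<in>T. ce (A i) x) \<le> 1"
    using prod_ce_bounds[of A, OF assms] by (rule AE_mp) auto
qed measurable

lemma weight_nonneg:
  assumes "\<And>i. i \<in> T \<Longrightarrow> A i \<in> sets N" shows "0 \<le> weight A"
  unfolding weight_def
proof (rule integral_nonneg_AE)
  show "AE x in N. 0 \<le> (\<Prod>i\<in>T. ce (A i) x)"
    using prod_ce_bounds[of A, OF assms] by (rule AE_mp) auto
qed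

text \<open>Only finitely many sets \<open>\<S>\<close> serve as sides, and they generate a finite partition. The conditional
  probabilities of its cells at \<open>x\<close> define a probability vector, and expanding the product of sums
  exhibits \<open>\<Prod>\<^sub>i E(A\<^sub>i)(x)\<close> as the mass that the corresponding product measure gives to the
  rectangle. That measure is carried by one representative tuple \<open>Y g\<close> for each tuple \<open>g\<close> of cells, and the
  representatives do not depend on \<open>x\<close>.\<close>

lemma prod_ce_discrete:
  assumes S: "finite \<S>" "\<S> \<subseteq> sets N"
  obtains \<Gamma> :: "(nat \<Rightarrow> 'x set set) set" and Y
  where "finite \<Gamma>" and "Y \<in> \<Gamma> \<rightarrow> T \<rightarrow>\<^sub>E UNIV"
    and "AE x in N. \<exists>W. (\<forall>g\<in>\<Gamma>. 0 \<le> W g) \<and> (\<forall>A\<in>T \<rightarrow> \<S>.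
      (\<Prod>i\<in>T. ce (A i) x) = (\<Sum>g\<in>\<Gamma>. W g * indicat_real (Pi\<^sub>E T A) (Y g)))"
proof -
  define L where "L x = {A \<in> \<S>. x \<in> A}" for x
  define R where "R = range L"
  have "R \<subseteq> Pow \<S>" by (auto simp: R_def L_def)
  then have R: "finite R" using S by (auto intro: finite_subset)
  have cell: "L -` {a} \<in> sets N" for a
  proof -
    have "L x = a \<longleftrightarrow> a \<subseteq> \<S> \<and> (\<forall>A\<in>\<S>. x \<in> (if A \<in> a then A else - A))" for x
      unfolding L_def by (simp split: if_split) blast
    then have "L -` {a} = (if a \<subseteq> \<S> then UNIV \<inter> (\<Inter>A\<in>\<S>. if A \<in> a then A else - A) else {})"
      by (simp only: vimage_def singleton_iff INTER_eq) simp
    moreover have "UNIV \<inter> (\<Inter>A\<in>\<S>. if A \<in> a then A else - A) \<in> sets N"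
    proof (cases "\<S> = {}")
      case False
      have "(\<Inter>A\<in>\<S>. if A \<in> a then A else - A) \<in> sets N"
        using S False Compl_sets by (intro sets.finite_INT) auto
      then show ?thesis by simp
    qed simp
    ultimately show ?thesis by simp
  qed
  define Y where "Y g = (\<lambda>i\<in>T. SOME y. L y = g i)" for g :: "nat \<Rightarrow> 'x set set"
  define \<Gamma> where "\<Gamma> = (T \<rightarrow>\<^sub>E R)"
  have fin: "finite \<Gamma>" unfolding \<Gamma>_def by (intro finite_PiE finite_T R)
  have Y: "L (Y g i) = g i" if "g \<in> \<Gamma>" "i \<in> T" for g i
  proof -
    have "g i \<in> R" using that by (auto simp: \<Gamma>_def)
    then have "\<exists>y. L y = g i" by (auto simp: R_def)
    then show ?thesis using that someI_ex[of "\<lambda>y. L y = g i"] by (simp add: Y_def)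
  qed
  have sum_cells: "AE x in N. ce A x = (\<Sum>a\<in>{a\<in>R. A \<in> a}. ce (L -` {a}) x)" if "A \<in> \<S>" for A
  proof -
    have "indicat_real A = (\<lambda>x. \<Sum>a\<in>{a\<in>R. A \<in> a}. indicat_real (L -` {a}) x)"
    proof
      fix x
      have "(\<Sum>a\<in>{a\<in>R. A \<in> a}. indicat_real (L -` {a}) x)
        = (\<Sum>a\<in>{a\<in>R. A \<in> a}. if a = L x then 1 else 0)"
        by (intro sum.cong) (auto simp: indicator_def)
      also have "\<dots> = indicat_real A x"
        using R that by (simp add: R_def L_def indicator_def)
      finally show "indicat_real A x = (\<Sum>a\<in>{a\<in>R. A \<in> a}. indicat_real (L -` {a}) x)" by simp
    qed
    then show ?thesis
      using real_cond_exp_sum[of "\<lambda>a. indicat_real (L -` {a})" "{a\<in>R. A \<in> a}"] integrable_indicat[OF cell]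
      by simp
  qed
  have "AE x in N. (\<forall>A\<in>\<S>. ce A x = (\<Sum>a\<in>{a\<in>R. A \<in> a}. ce (L -` {a}) x))
      \<and> (\<forall>a\<in>R. 0 \<le> ce (L -` {a}) x)"
    using S R sum_cells ce_nonneg[OF cell]
    by (intro AE_conjI AE_finite_allI) auto
  then have "AE x in N. \<exists>W. (\<forall>g\<in>\<Gamma>. 0 \<le> W g) \<and> (\<forall>A\<in>T \<rightarrow> \<S>.
      (\<Prod>i\<in>T. ce (A i) x) = (\<Sum>g\<in>\<Gamma>. W g * indicat_real (Pi\<^sub>E T A) (Y g)))"
  proof eventually_elim
    case (elim x)
    let ?p = "\<lambda>a. ce (L -` {a}) x"
    show ?case
    proof (intro exI[of _ "\<lambda>g. \<Prod>i\<in>T. ?p (g i)"] conjI ballI)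
      fix g assume "g \<in> \<Gamma>"
      then show "0 \<le> (\<Prod>i\<in>T. ?p (g i))"
        using elim by (intro prod_nonneg) (auto simp: \<Gamma>_def)
    next
      fix A assume A: "A \<in> T \<rightarrow> \<S>"
      have "(\<Prod>i\<in>T. ce (A i) x) = (\<Prod>i\<in>T. \<Sum>a\<in>{a\<in>R. A i \<in> a}. ?p a)"
        using elim A by (intro prod.cong) auto
      also have "\<dots> = (\<Sum>g\<in>Pi\<^sub>E T (\<lambda>i. {a\<in>R. A i \<in> a}). \<Prod>i\<in>T. ?p (g i))"
        using R finite_T by (intro prod_sum_PiE) auto
      also have "\<dots> = (\<Sum>g\<in>\<Gamma>. (\<Prod>i\<in>T. ?p (g i)) * indicat_real (Pi\<^sub>E T A) (Y g))"
      proof (rule sum.mono_neutral_cong_left[OF fin])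
        show "Pi\<^sub>E T (\<lambda>i. {a\<in>R. A i \<in> a}) \<subseteq> \<Gamma>" by (auto simp: \<Gamma>_def PiE_iff)
        have Y_mem: "Y g \<in> Pi\<^sub>E T A \<longleftrightarrow> g \<in> Pi\<^sub>E T (\<lambda>i. {a\<in>R. A i \<in> a})" if g: "g \<in> \<Gamma>" for g
        proof -
          have "Y g i \<in> A i \<longleftrightarrow> A i \<in> g i" if i: "i \<in> T" for i
          proof -
            have "A i \<in> \<S>" using A i by auto
            then have "Y g i \<in> A i \<longleftrightarrow> A i \<in> L (Y g i)" by (simp add: L_def)
            then show ?thesis by (simp add: Y[OF g i])
          qed
          then show ?thesis using g by (auto simp: \<Gamma>_def PiE_iff Y_def)
        qed
        show "\<forall>g\<in>\<Gamma> - Pi\<^sub>E T (\<lambda>i. {a\<in>R. A i \<in> a}).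
            (\<Prod>i\<in>T. ?p (g i)) * indicat_real (Pi\<^sub>E T A) (Y g) = 0"
          using Y_mem by auto
        show "(\<Prod>i\<in>T. ?p (g i)) = (\<Prod>i\<in>T. ?p (g i)) * indicat_real (Pi\<^sub>E T A) (Y g)"
          if "g \<in> Pi\<^sub>E T (\<lambda>i. {a\<in>R. A i \<in> a})" for g
          using Y_mem[of g] that by (auto simp: \<Gamma>_def PiE_iff)
      qed
      finally show "(\<Prod>i\<in>T. ce (A i) x)
        = (\<Sum>g\<in>\<Gamma>. (\<Prod>i\<in>T. ?p (g i)) * indicat_real (Pi\<^sub>E T A) (Y g))" .
    qed
  qed
  then show ?thesis by (intro that[OF fin]) (auto simp: Y_def)
qed

text \<open>Finite additivity in its most useful form: an inequality between sums of indicator functions of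
  rectangles passes to the weights, because for almost every \<open>x\<close> it can be integrated against the discrete
  measure of the previous lemma.\<close>

lemma weight_sum_mono:
  fixes A :: "'k \<Rightarrow> nat \<Rightarrow> 'x set" and B :: "'l \<Rightarrow> nat \<Rightarrow> 'x set"
  assumes I: "finite I" and J: "finite J"
    and A: "\<And>k i. k \<in> I \<Longrightarrow> i \<in> T \<Longrightarrow> A k i \<in> sets N"
    and B: "\<And>l i. l \<in> J \<Longrightarrow> i \<in> T \<Longrightarrow> B l i \<in> sets N"
    and le: "\<And>y. y \<in> T \<rightarrow>\<^sub>E UNIV \<Longrightarrow> (\<Sum>k\<in>I. indicat_real (Pi\<^sub>E T (A k)) y)
      \<le> (\<Sum>l\<in>J. indicat_real (Pi\<^sub>E T (B l)) y)"
  shows "(\<Sum>k\<in>I. weight (A k)) \<le> (\<Sum>l\<in>J. weight (B l))"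
proof -
  define \<S> where "\<S> = (\<Union>k\<in>I. A k ` T) \<union> (\<Union>l\<in>J. B l ` T)"
  have "finite \<S>" "\<S> \<subseteq> sets N" using I J finite_T A B by (auto simp: \<S>_def)
  then obtain \<Gamma> :: "(nat \<Rightarrow> 'x set set) set" and Y
    where \<Gamma>: "finite \<Gamma>" and Y: "Y \<in> \<Gamma> \<rightarrow> T \<rightarrow>\<^sub>E UNIV"
      and ae: "AE x in N. \<exists>W. (\<forall>g\<in>\<Gamma>. 0 \<le> W g) \<and> (\<forall>A\<in>T \<rightarrow> \<S>.
      (\<Prod>i\<in>T. ce (A i) x) = (\<Sum>g\<in>\<Gamma>. W g * indicat_real (Pi\<^sub>E T A) (Y g)))"
    by (rule prod_ce_discrete)
  have AS: "A k \<in> T \<rightarrow> \<S>" if "k \<in> I" for k using that by (auto simp: \<S>_def)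
  have BS: "B l \<in> T \<rightarrow> \<S>" if "l \<in> J" for l using that by (auto simp: \<S>_def)
  have "AE x in N. (\<Sum>k\<in>I. \<Prod>i\<in>T. ce (A k i) x) \<le> (\<Sum>l\<in>J. \<Prod>i\<in>T. ce (B l i) x)"
    using ae
  proof eventually_elim
    case (elim x)
    then obtain W where W: "\<And>g. g \<in> \<Gamma> \<Longrightarrow> 0 \<le> W g" and eq: "\<And>A. A \<in> T \<rightarrow> \<S> \<Longrightarrow>
      (\<Prod>i\<in>T. ce (A i) x) = (\<Sum>g\<in>\<Gamma>. W g * indicat_real (Pi\<^sub>E T A) (Y g))" by blast
    have "(\<Sum>k\<in>I. \<Prod>i\<in>T. ce (A k i) x) = (\<Sum>k\<in>I. \<Sum>g\<in>\<Gamma>. W g * indicat_real (Pi\<^sub>E T (A k)) (Y g))"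
      by (intro sum.cong refl eq AS)
    also have "\<dots> = (\<Sum>g\<in>\<Gamma>. W g * (\<Sum>k\<in>I. indicat_real (Pi\<^sub>E T (A k)) (Y g)))"
      by (subst sum.swap) (simp add: sum_distrib_left)
    also have "\<dots> \<le> (\<Sum>g\<in>\<Gamma>. W g * (\<Sum>l\<in>J. indicat_real (Pi\<^sub>E T (B l)) (Y g)))"
      by (intro sum_mono mult_left_mono le W funcset_mem[OF Y])
    also have "\<dots> = (\<Sum>l\<in>J. \<Sum>g\<in>\<Gamma>. W g * indicat_real (Pi\<^sub>E T (B l)) (Y g))"
      by (subst sum.swap) (simp add: sum_distrib_left)
    also have "\<dots> = (\<Sum>l\<in>J. \<Prod>i\<in>T. ce (B l i) x)"
      by (intro sum.cong refl eq[symmetric] BS)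
    finally show ?case .
  qed
  then have "(\<integral>x. (\<Sum>k\<in>I. \<Prod>i\<in>T. ce (A k i) x) \<partial>N) \<le> (\<integral>x. (\<Sum>l\<in>J. \<Prod>i\<in>T. ce (B l i) x) \<partial>N)"
    by (intro integral_mono_AE Bochner_Integration.integrable_sum integrable_prod_ce A B)
  moreover have "(\<integral>x. (\<Sum>k\<in>I. \<Prod>i\<in>T. ce (A k i) x) \<partial>N) = (\<Sum>k\<in>I. weight (A k))"
    unfolding weight_def by (intro Bochner_Integration.integral_sum integrable_prod_ce A)
  moreover have "(\<integral>x. (\<Sum>l\<in>J. \<Prod>i\<in>T. ce (B l i) x) \<partial>N) = (\<Sum>l\<in>J. weight (B l))"
    unfolding weight_def by (intro Bochner_Integration.integral_sum integrable_prod_ce B)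
  ultimately show ?thesis by simp
qed

lemma weight_le_sum:
  assumes "finite J" and "\<And>i. i \<in> T \<Longrightarrow> A i \<in> sets N"
    and "\<And>l i. l \<in> J \<Longrightarrow> i \<in> T \<Longrightarrow> B l i \<in> sets N"
    and cover: "Pi\<^sub>E T A \<subseteq> (\<Union>l\<in>J. Pi\<^sub>E T (B l))"
  shows "weight A \<le> (\<Sum>l\<in>J. weight (B l))"
proof -
  have "(\<Sum>k\<in>{()}. weight A) \<le> (\<Sum>l\<in>J. weight (B l))"
  proof (rule weight_sum_mono)
    fix y
    show "(\<Sum>k\<in>{()}. indicat_real (Pi\<^sub>E T A) y) \<le> (\<Sum>l\<in>J. indicat_real (Pi\<^sub>E T (B l)) y)"
    proof (cases "y \<in> Pi\<^sub>E T A")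
      case True
      then obtain l where l: "l \<in> J" "y \<in> Pi\<^sub>E T (B l)" using cover by blast
      have "indicat_real (Pi\<^sub>E T (B l)) y \<le> (\<Sum>l\<in>J. indicat_real (Pi\<^sub>E T (B l)) y)"
        using assms(1) l(1) by (intro member_le_sum) auto
      then show ?thesis using True l by simp
    qed (simp add: sum_nonneg)
  qed (use assms in auto)
  then show ?thesis by simp
qed

text \<open>The marginals of the product are \<open>N\<close> itself.\<close>

lemma weight_slab:
  assumes i: "i \<in> T" and D: "D \<in> sets N"
  shows "weight (\<lambda>j. if j = i then D else UNIV) = measure N D"
proof -
  have "weight (\<lambda>j. if j = i then D else UNIV) = (\<integral>x. ce D x \<partial>N)"
    unfolding weight_def
  proof (rule integral_cong_AE)
    show "AE x in N. (\<Prod>j\<in>T. ce (if j = i then D else UNIV) x) = ce D x"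
      using ce_UNIV
    proof eventually_elim
      case (elim x)
      have "(\<Prod>j\<in>T. ce (if j = i then D else UNIV) x) = (\<Prod>j\<in>T. if j = i then ce D x else 1)"
        using elim by (intro prod.cong) auto
      then show ?case using i finite_T by simp
    qed
  qed measurable
  then show ?thesis using integral_ce[OF D] by simp
qed

text \<open>A point of the larger rectangle outside the smaller one has some coordinate \<open>i\<close> in \<open>B i - A i\<close>, that
  is, lies in one of the slabs over these differences.\<close>

lemma weight_le_subrectangle:
  assumes A: "\<And>i. i \<in> T \<Longrightarrow> A i \<in> sets N" and B: "\<And>i. i \<in> T \<Longrightarrow> B i \<in> sets N"
  shows "weight B \<le> weight A + (\<Sum>i\<in>T. measure N (B i - A i))"
proof -
  let ?C = "case_option A (\<lambda>i j. if j = i then B i - A i else UNIV)"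
  have "weight B \<le> (\<Sum>l\<in>insert None (Some ` T). weight (?C l))"
  proof (rule weight_le_sum)
    show "Pi\<^sub>E T B \<subseteq> (\<Union>l\<in>insert None (Some ` T). Pi\<^sub>E T (?C l))"
      by (auto simp: PiE_iff split: if_splits)
  qed (use A B finite_T in \<open>auto split: if_splits\<close>)
  also have "\<dots> = weight A + (\<Sum>i\<in>T. weight (\<lambda>j. if j = i then B i - A i else UNIV))"
    using finite_T by (simp add: sum.reindex image_iff)
  also have "(\<Sum>i\<in>T. weight (\<lambda>j. if j = i then B i - A i else UNIV)) = (\<Sum>i\<in>T. measure N (B i - A i))"
    using A B by (intro sum.cong refl weight_slab) auto
  finally show ?thesis .
qed

text \<open>A difference of rectangles is cut up according to the first coordinate \<open>j\<close> that leaves \<open>B\<close>.\<close>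

lemma semiring_rectangles:
  "semiring_of_sets (T \<rightarrow>\<^sub>E UNIV) (Pi\<^sub>E T ` (T \<rightarrow> sets N))"
proof (unfold_locales, goal_cases)
  case 1
  show ?case by (auto simp: PiE_iff)
next
  case 2
  have "{} = Pi\<^sub>E T (\<lambda>_. {})" using T_nonempty by (auto simp: PiE_iff)
  then show ?case by auto
next
  case (3 a b)
  then obtain A B where "A \<in> T \<rightarrow> sets N" "B \<in> T \<rightarrow> sets N" "a = Pi\<^sub>E T A" "b = Pi\<^sub>E T B" by auto
  then show ?case
    by (intro image_eqI[of _ _ "\<lambda>i. A i \<inter> B i"]) (auto simp: PiE_Int Pi_iff)
next
  case (4 a b)
  then obtain A B where A: "A \<in> T \<rightarrow> sets N" and B: "B \<in> T \<rightarrow> sets N"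
    and ab: "a = Pi\<^sub>E T A" "b = Pi\<^sub>E T B" by auto
  let ?C = "\<lambda>j i. if i < j then A i \<inter> B i else if i = j then A i - B i else A i"
  let ?\<C> = "(\<lambda>j. Pi\<^sub>E T (?C j)) ` T"
  show ?case
  proof (intro exI[of _ ?\<C>] conjI)
    show "?\<C> \<subseteq> Pi\<^sub>E T ` (T \<rightarrow> sets N)" using A B by (auto intro!: imageI simp: Pi_iff)
    show "finite ?\<C>" using finite_T by simp
    have less: "Pi\<^sub>E T (?C j) \<inter> Pi\<^sub>E T (?C k) = {}" if "j \<in> T" "k \<in> T" "j < k" for j k
    proof (intro equals0I)
      fix y assume y: "y \<in> Pi\<^sub>E T (?C j) \<inter> Pi\<^sub>E T (?C k)"
      then have "y j \<in> ?C j j" "y j \<in> ?C k j" using that by (auto simp: PiE_iff)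
      then show False using that by simp
    qed
    have "Pi\<^sub>E T (?C j) \<inter> Pi\<^sub>E T (?C k) = {}" if jk: "j \<in> T" "k \<in> T" "j \<noteq> k" for j k
    proof (cases "j < k")
      case True
      then show ?thesis by (rule less[OF jk(1,2)])
    next
      case False
      then have "k < j" using jk by simp
      from less[OF jk(2,1) this] show ?thesis by (simp only: Int_commute)
    qed
    then show "disjoint ?\<C>"
      by (intro pairwise_imageI) (simp only: disjnt_def not_False_eq_True)
    show "a - b = \<Union>?\<C>"
    proof (intro subset_antisym subsetI)
      fix y assume y: "y \<in> a - b"
      then have ex: "\<exists>j. j \<in> T \<and> y j \<notin> B j" by (auto simp: ab PiE_iff)
      define j where "j = (LEAST j. j \<in> T \<and> y j \<notin> B j)"
      have j: "j \<in> T" "y j \<notin> B j" using LeastI_ex[OF ex] by (auto simp: j_def)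
      have less: "y i \<in> B i" if "i < j" "i \<in> T" for i using not_less_Least that by (auto simp: j_def)
      have "y \<in> Pi\<^sub>E T (?C j)" using y j less by (auto simp: ab PiE_iff)
      then show "y \<in> \<Union>?\<C>" using j by blast
    next
      fix y assume "y \<in> \<Union>?\<C>"
      then obtain j where j: "j \<in> T" and y: "y \<in> Pi\<^sub>E T (?C j)" by auto
      have "y i \<in> A i" if "i \<in> T" for i using PiE_mem[OF y that] by (auto split: if_splits)
      moreover have "y j \<notin> B j" using PiE_mem[OF y j] by simp
      moreover have "y \<in> extensional T" using y by (simp add: PiE_iff)
      ultimately show "y \<in> a - b" using j by (auto simp: ab PiE_iff)
    qed
  qed
qed

end

section \<open>Regularity of finite measures on metric spaces\<close>

text \<open>Closed and open approximation defines a \<open>\<sigma>\<close>-algebra, and an open set is exhausted by the closed sets of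
  points at distance at least \<open>1 / k\<close> from its complement.\<close>

lemma finite_measure_closed_open_approx:
  fixes M :: "'x::metric_space measure"
  assumes fin: "finite_measure M" and M: "sets M = sets borel"
    and A: "A \<in> sets borel" and e: "0 < (e::real)"
  shows "\<exists>F U. closed F \<and> open U \<and> F \<subseteq> A \<and> A \<subseteq> U \<and> measure M (U - F) < e"
proof -
  interpret finite_measure M by (rule fin)
  note [simp] = M
  have "A \<in> sigma_sets UNIV {S. open S}" using A by (simp add: borel_def)
  then show ?thesis using e
  proof (induction arbitrary: e rule: sigma_sets.induct)
    case (Basic a)
    then have "open a" by simp
    show ?case
    proof (cases "a = UNIV")
      case True
      then show ?thesis using Basic by (intro exI[of _ UNIV]) auto
    next
      case False
      define F where "F k = {x. 1 / real (Suc k) \<le> infdist x (- a)}" for k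
      have "closed (F k)" for k
        unfolding F_def by (intro closed_Collect_le continuous_intros)
      moreover have Fa: "F k \<subseteq> a" for k
      proof
        fix x assume "x \<in> F k"
        then have "infdist x (- a) \<noteq> 0" by (auto simp: F_def)
        then show "x \<in> a" using infdist_zero[of x "- a"] by blast
      qed
      moreover have "(\<Inter>k. a - F k) = {}"
      proof (intro equals0I)
        fix x assume x: "x \<in> (\<Inter>k. a - F k)"
        then have "x \<notin> - a" by auto
        then have "infdist x (- a) \<noteq> 0"
          using in_closed_iff_infdist_zero[of "- a" x] \<open>open a\<close> False by auto
        then have "0 < infdist x (- a)" using infdist_nonneg[of x "- a"] by simp
        then obtain k where "1 / real (Suc k) < infdist x (- a)"
          using reals_Archimedean[of "infdist x (- a)"] by (auto simp: field_simps)
        then have "x \<in> F k" by (simp add: F_def less_imp_le)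
        then show False using x by auto
      qed
      moreover have "decseq (\<lambda>k. a - F k)"
      proof (intro decseq_SucI subsetI)
        fix k x assume "x \<in> a - F (Suc k)"
        moreover have "1 / real (Suc (Suc k)) \<le> 1 / real (Suc k)" by (simp add: field_simps)
        ultimately show "x \<in> a - F k" by (auto simp: F_def simp del: of_nat_Suc)
      qed
      moreover have "range (\<lambda>k. a - F k) \<subseteq> sets M"
        using \<open>open a\<close> \<open>\<And>k. closed (F k)\<close> by auto
      ultimately have "(\<lambda>k. measure M (a - F k)) \<longlonglongrightarrow> 0"
        using finite_Lim_measure_decseq[of "\<lambda>k. a - F k"] by (simp only: measure_empty)
      then have "\<forall>\<^sub>F k in sequentially. measure M (a - F k) < e"
        using Basic by (intro order_tendstoD)
      then obtain k where "measure M (a - F k) < e" by (auto simp: eventually_sequentially)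
      then show ?thesis
        using \<open>open a\<close> \<open>\<And>k. closed (F k)\<close> Fa by (intro exI[of _ "F k"] exI[of _ a]) auto
    qed
  next
    case Empty
    then show ?case by (intro exI[of _ "{}"]) auto
  next
    case (Compl a)
    then obtain F U where FU: "closed F" "open U" "F \<subseteq> a" "a \<subseteq> U" "measure M (U - F) < e" by metis
    moreover have "- F - - U = U - F" by auto
    ultimately show ?case by (intro exI[of _ "- U"] exI[of _ "- F"]) auto
  next
    case (Union a)
    have pos: "0 < e / 2 * (1/2) ^ Suc i" for i :: nat using Union.prems by simp
    have "\<forall>i. \<exists>F U. closed F \<and> open U \<and> F \<subseteq> a i \<and> a i \<subseteq> U \<and> measure M (U - F) < e / 2 * (1/2) ^ Suc i"
      using Union.IH pos by blast
    then obtain F U where F: "\<And>i. closed (F i)" "\<And>i. F i \<subseteq> a i"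
      and U: "\<And>i. open (U i)" "\<And>i. a i \<subseteq> U i"
      and UF: "\<And>i. measure M (U i - F i) < e / 2 * (1/2) ^ Suc i" by metis
    have ms: "F i \<in> sets M" "U i \<in> sets M" for i using F U by auto
    have geo: "(\<lambda>i. e / 2 * (1/2) ^ Suc i) sums (e / 2)"
      using sums_mult[OF power_half_series, of "e / 2"] by simp
    have summ: "summable (\<lambda>i. measure M (U i - F i))"
      using UF by (intro summable_comparison_test'[OF sums_summable[OF geo]]) (auto intro: less_imp_le)
    let ?D = "\<lambda>k. (\<Union>i. U i) - (\<Union>i<k. F i)"
    have "?D k \<in> sets M" for k
      using ms by (intro sets.Diff sets.countable_UN' sets.finite_UN) auto
    then have "range ?D \<subseteq> sets M" by blast
    moreover have "decseq ?D" by (intro decseq_SucI) (auto simp: lessThan_Suc)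
    ultimately have "(\<lambda>k. measure M (?D k)) \<longlonglongrightarrow> measure M (\<Inter>k. ?D k)"
      by (rule finite_Lim_measure_decseq)
    moreover have "measure M (\<Inter>k. ?D k) < e"
    proof -
      have "(\<Inter>k. ?D k) \<subseteq> (\<Union>i. U i - F i)"
      proof
        fix x assume x: "x \<in> (\<Inter>k. ?D k)"
        then obtain i where "x \<in> U i" by blast
        moreover have "x \<in> ?D (Suc i)" using x by blast
        ultimately show "x \<in> (\<Union>i. U i - F i)" by auto
      qed
      then have "measure M (\<Inter>k. ?D k) \<le> measure M (\<Union>i. U i - F i)"
        using ms by (intro finite_measure_mono) auto
      also have "\<dots> \<le> (\<Sum>i. measure M (U i - F i))"
        using ms by (intro finite_measure_subadditive_countably summ) auto
      also have "\<dots> \<le> e / 2"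
        using suminf_le[OF _ summ sums_summable[OF geo]] UF sums_unique[OF geo]
        by (simp add: less_imp_le)
      also have "\<dots> < e" using Union.prems by simp
      finally show ?thesis .
    qed
    ultimately have "\<forall>\<^sub>F k in sequentially. measure M (?D k) < e" by (rule order_tendstoD)
    then obtain k where k: "measure M (?D k) < e" by (auto simp: eventually_sequentially)
    show ?case
    proof (intro exI conjI)
      show "closed (\<Union>i<k. F i)" using F by (intro closed_UN) auto
      show "open (\<Union>i. U i)" using U by auto
      show "(\<Union>i<k. F i) \<subseteq> (\<Union>i. a i)" using F by blast
      show "(\<Union>i. a i) \<subseteq> (\<Union>i. U i)" using U by blast
    qed (rule k)
  qed
qed

lemma completion_closed_open_approx:
  fixes M :: "'x::metric_space measure"
  assumes fin: "finite_measure M" and M: "sets M = sets borel"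
    and A: "A \<in> sets (completion M)" and e: "0 < (e::real)"
  shows "\<exists>F U. closed F \<and> open U \<and> F \<subseteq> A \<and> A \<subseteq> U \<and> measure (completion M) (U - F) < e"
proof -
  interpret finite_measure M by (rule fin)
  obtain S Z Z' where A_eq: "A = S \<union> Z" and Z: "Z \<subseteq> Z'" "Z' \<in> null_sets M" and S: "S \<in> sets M"
    using A by (rule sets_completionE)
  have Z': "Z' \<in> sets M" "measure M Z' = 0" using Z by (auto simp: measure_eq_0_null_sets)
  obtain F1 U1 where 1: "closed F1" "open U1" "F1 \<subseteq> S" "S \<subseteq> U1" "measure M (U1 - F1) < e / 2"
    using finite_measure_closed_open_approx[OF fin M, of S "e / 2"] S M e by auto
  obtain F2 U2 where 2: "closed F2" "open U2" "F2 \<subseteq> S \<union> Z'" "S \<union> Z' \<subseteq> U2" "measure M (U2 - F2) < e / 2"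
    using finite_measure_closed_open_approx[OF fin M, of "S \<union> Z'" "e / 2"] S Z' M e by auto
  have ms: "U1 - F1 \<in> sets M" "U2 - F2 \<in> sets M" "U2 - F1 \<in> sets M" using 1 2 M by auto
  have "measure M (U2 - F1) \<le> measure M ((U1 - F1) \<union> (U2 - F2) \<union> Z')"
    using 1 2 ms Z' by (intro finite_measure_mono) auto
  also have "\<dots> \<le> measure M ((U1 - F1) \<union> (U2 - F2)) + measure M Z'"
    using ms Z' by (intro measure_Un_le) auto
  also have "\<dots> \<le> measure M (U1 - F1) + measure M (U2 - F2) + measure M Z'"
    using ms by (intro add_right_mono measure_Un_le)
  also have "\<dots> < e" using 1 2 Z' by simp
  finally have "measure (completion M) (U2 - F1) < e" using ms by simp
  moreover have "F1 \<subseteq> A" "A \<subseteq> U2" using 1 2 A_eq Z by auto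
  ultimately show ?thesis using 1(1) 2(2) by blast
qed

section \<open>Countable additivity on rectangles\<close>

locale regular_cond_exp_product = cond_exp_product N P T
  for N :: "'x::metric_space measure" and P T +
  assumes compact_UNIV: "compact (UNIV :: 'x set)"
    and borel_sets: "sets borel \<subseteq> sets N"
    and regular: "A \<in> sets N \<Longrightarrow> 0 < (e::real) \<Longrightarrow>
      \<exists>F U. closed F \<and> open U \<and> F \<subseteq> A \<and> A \<subseteq> U \<and> measure N (U - F) < e"
begin

lemma closed_sets: "closed F \<Longrightarrow> F \<in> sets N" and open_sets: "open U \<Longrightarrow> U \<in> sets N"
  using borel_sets by auto

text \<open>The Marczewski--Ryll-Nardzewski argument. Shrink the sides of \<open>B\<close> to compact sets and enlarge the
  sides of the \<open>A k\<close> to open sets. The change of the weights is controlled by the marginals alone, and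
  compactness of the shrunk rectangle leaves a finite cover, to which finite subadditivity applies.\<close>

lemma weight_le_suminf:
  fixes A :: "nat \<Rightarrow> nat \<Rightarrow> 'x set"
  assumes A: "\<And>k i. i \<in> T \<Longrightarrow> A k i \<in> sets N" and B: "\<And>i. i \<in> T \<Longrightarrow> B i \<in> sets N"
    and cover: "Pi\<^sub>E T B \<subseteq> (\<Union>k. Pi\<^sub>E T (A k))"
  shows "ennreal (weight B) \<le> (\<Sum>k. ennreal (weight (A k)))"
proof (rule ennreal_le_epsilon)
  fix e :: real assume e: "0 < e"
  have cT: "0 < real (card T)" using finite_T T_nonempty by (simp add: card_gt_0_iff)
  \<comment> \<open>Shrinking \<open>B\<close> costs \<open>e / 4\<close>, and enlarging all the \<open>A k\<close> costs \<open>e / 4 * (1 + 1/2 + \<dots>) = e / 2\<close>.\<close>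
  define d where "d = e / (4 * real (card T))"
  have d: "0 < d" "real (card T) * d = e / 4" using e cT by (auto simp: d_def)
  have "\<exists>F. closed F \<and> F \<subseteq> B i \<and> measure N (B i - F) \<le> d" if i: "i \<in> T" for i
  proof -
    obtain F U where FU: "closed F" "open U" "F \<subseteq> B i" "B i \<subseteq> U" "measure N (U - F) < d"
      using regular[OF B[OF i] d(1)] by auto
    have "measure N (B i - F) \<le> measure N (U - F)"
      using FU closed_sets open_sets by (intro finite_measure_mono) auto
    then show ?thesis using FU by (intro exI[of _ F]) auto
  qed
  then obtain K where K: "\<And>i. i \<in> T \<Longrightarrow> closed (K i)" "\<And>i. i \<in> T \<Longrightarrow> K i \<subseteq> B i"
    "\<And>i. i \<in> T \<Longrightarrow> measure N (B i - K i) \<le> d" by metis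
  have ex_U: "\<exists>U. open U \<and> A k i \<subseteq> U \<and> measure N (U - A k i) \<le> d * (1/2)^k" if i: "i \<in> T" for k i
  proof -
    have pos: "0 < d * (1/2)^k" using d by simp
    obtain F U where FU: "closed F" "open U" "F \<subseteq> A k i" "A k i \<subseteq> U"
      "measure N (U - F) < d * (1/2)^k"
      using regular[OF A[OF i, of k] pos] by auto
    have "measure N (U - A k i) \<le> measure N (U - F)"
      using FU closed_sets open_sets by (intro finite_measure_mono) auto
    then show ?thesis using FU by (intro exI[of _ U]) auto
  qed
  define U where "U k i = (SOME U. open U \<and> A k i \<subseteq> U \<and> measure N (U - A k i) \<le> d * (1/2)^k)" for k i
  have U: "open (U k i)" "A k i \<subseteq> U k i" "measure N (U k i - A k i) \<le> d * (1/2)^k"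
    if "i \<in> T" for k i
    using someI_ex[OF ex_U[OF that]] by (auto simp: U_def)
  have Ks: "K i \<in> sets N" if "i \<in> T" for i using K that closed_sets by auto
  have Us: "U k i \<in> sets N" if "i \<in> T" for k i using U that open_sets by auto
  let ?X = "product_topology (\<lambda>_. euclidean :: 'x topology) T"
  have "compactin ?X (Pi\<^sub>E T K)"
    unfolding compactin_PiE using K compact_UNIV closed_Int_compact[OF _ compact_UNIV] by auto
  moreover have "openin ?X V" if "V \<in> range (\<lambda>k. Pi\<^sub>E T (U k))" for V
    using that U finite_T by (auto simp: openin_PiE)
  moreover have "Pi\<^sub>E T K \<subseteq> \<Union>(range (\<lambda>k. Pi\<^sub>E T (U k)))"
  proof
    fix y assume y: "y \<in> Pi\<^sub>E T K"
    have "Pi\<^sub>E T K \<subseteq> Pi\<^sub>E T B" by (rule PiE_mono) (rule K(2))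
    then have "y \<in> Pi\<^sub>E T B" using y by (rule subsetD)
    then obtain k where "y \<in> Pi\<^sub>E T (A k)" using cover by blast
    moreover have "Pi\<^sub>E T (A k) \<subseteq> Pi\<^sub>E T (U k)" by (rule PiE_mono) (rule U(2))
    ultimately have "y \<in> Pi\<^sub>E T (U k)" by (meson subsetD)
    then show "y \<in> \<Union>(range (\<lambda>k. Pi\<^sub>E T (U k)))" by blast
  qed
  ultimately have "\<exists>\<F>. finite \<F> \<and> \<F> \<subseteq> range (\<lambda>k. Pi\<^sub>E T (U k)) \<and> Pi\<^sub>E T K \<subseteq> \<Union>\<F>"
    by (rule compactinD)
  then obtain J where J: "finite J" "Pi\<^sub>E T K \<subseteq> (\<Union>k\<in>J. Pi\<^sub>E T (U k))"
    by (metis finite_subset_image)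
  have "weight B \<le> weight K + (\<Sum>i\<in>T. measure N (B i - K i))"
    by (intro weight_le_subrectangle Ks B)
  also have "\<dots> \<le> weight K + (\<Sum>i\<in>T. d)"
    by (intro add_left_mono sum_mono K)
  also have "\<dots> = weight K + e / 4" using d by simp
  also have "weight K \<le> (\<Sum>k\<in>J. weight (U k))"
    using J Ks Us by (intro weight_le_sum) auto
  also have "\<dots> \<le> (\<Sum>k\<in>J. weight (A k) + (\<Sum>i\<in>T. measure N (U k i - A k i)))"
    by (intro sum_mono weight_le_subrectangle A Us)
  also have "\<dots> \<le> (\<Sum>k\<in>J. weight (A k) + (\<Sum>i\<in>T. d * (1/2)^k))"
    by (intro sum_mono add_left_mono U)
  also have "\<dots> = (\<Sum>k\<in>J. weight (A k)) + (\<Sum>k\<in>J. e / 4 * (1/2)^k)"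
  proof -
    have "(\<Sum>i\<in>T. d * (1/2)^k) = e / 4 * (1/2)^k" for k
      by (simp only: sum_constant d(2)[symmetric] mult.assoc)
    then show ?thesis by (simp only: sum.distrib)
  qed
  also have "(\<Sum>k\<in>J. e / 4 * (1/2)^k) \<le> (\<Sum>k. e / 4 * (1/2)^k)"
    using e J by (intro sum_le_suminf summable_mult summable_geometric) auto
  also have "\<dots> = e / 2"
    by (subst suminf_mult[OF summable_geometric]) (simp_all add: suminf_geometric)
  finally have le: "weight B \<le> (\<Sum>k\<in>J. weight (A k)) + e" using e by simp
  have "ennreal (weight B) \<le> ennreal ((\<Sum>k\<in>J. weight (A k)) + e)"
    by (rule ennreal_leI[OF le])
  also have "\<dots> = (\<Sum>k\<in>J. ennreal (weight (A k))) + ennreal e"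
    using e weight_nonneg[OF A] by (simp add: ennreal_plus sum_ennreal sum_nonneg)
  also have "(\<Sum>k\<in>J. ennreal (weight (A k))) \<le> (\<Sum>k. ennreal (weight (A k)))"
    using J by (intro sum_le_suminf) auto
  finally show "ennreal (weight B) \<le> (\<Sum>k. ennreal (weight (A k))) + ennreal e"
    by (simp add: add_right_mono)
qed

lemma suminf_weight_le:
  fixes A :: "nat \<Rightarrow> nat \<Rightarrow> 'x set"
  assumes A: "\<And>k i. i \<in> T \<Longrightarrow> A k i \<in> sets N" and B: "\<And>i. i \<in> T \<Longrightarrow> B i \<in> sets N"
    and disj: "disjoint_family (\<lambda>k. Pi\<^sub>E T (A k))" and sub: "\<And>k. Pi\<^sub>E T (A k) \<subseteq> Pi\<^sub>E T B"
  shows "(\<Sum>k. ennreal (weight (A k))) \<le> ennreal (weight B)"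
  unfolding suminf_eq_SUP
proof (rule SUP_least)
  fix m
  have "(\<Sum>k\<in>{..<m}. weight (A k)) \<le> (\<Sum>l\<in>{()}. weight B)"
  proof (rule weight_sum_mono)
    fix y
    have "(\<Sum>k\<in>{..<m}. indicat_real (Pi\<^sub>E T (A k)) y) = indicator (\<Union>k\<in>{..<m}. Pi\<^sub>E T (A k)) y"
      using disj by (intro indicator_UN_disjoint[symmetric])
        (auto intro: disjoint_family_on_mono[OF subset_UNIV])
    also have "\<dots> \<le> (\<Sum>l\<in>{()}. indicat_real (Pi\<^sub>E T B) y)"
      using sub by (auto simp: indicator_def)
    finally show "(\<Sum>k\<in>{..<m}. indicat_real (Pi\<^sub>E T (A k)) y) \<le> (\<Sum>l\<in>{()}. indicat_real (Pi\<^sub>E T B) y)" .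
  qed (use A B in auto)
  then show "(\<Sum>k<m. ennreal (weight (A k))) \<le> ennreal (weight B)"
    using weight_nonneg[OF A] by (simp add: sum_ennreal ennreal_leI)
qed

lemma emeasure_extend_rectangle:
  assumes M: "M = extend_measure (T \<rightarrow>\<^sub>E UNIV) (T \<rightarrow> sets N) (\<lambda>A. Pi\<^sub>E T A) (\<lambda>A. ennreal (weight A))"
    and A: "A \<in> T \<rightarrow> sets N"
  shows "emeasure M (Pi\<^sub>E T A) = ennreal (weight A)"
proof (rule extend_measure_caratheodory[OF M A semiring_rectangles])
  fix A assume "A \<in> T \<rightarrow> sets N" "Pi\<^sub>E T A = {}"
  then have "weight A \<le> (\<Sum>l\<in>{}. weight (\<lambda>_. {}))"
    by (intro weight_le_sum) (auto simp: Pi_iff)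
  then show "ennreal (weight A) = 0" by (simp add: ennreal_eq_0_iff)
next
  fix A B assume AB: "A \<in> T \<rightarrow> sets N" "B \<in> T \<rightarrow> sets N" "Pi\<^sub>E T A = Pi\<^sub>E T B"
  have "weight A \<le> (\<Sum>l\<in>{()}. weight B)" "weight B \<le> (\<Sum>l\<in>{()}. weight A)"
    using AB by (intro weight_le_sum; auto simp: Pi_iff)+
  then show "ennreal (weight A) = ennreal (weight B)" by simp
next
  fix A :: "nat \<Rightarrow> nat \<Rightarrow> 'x set" and B
  assume A: "A \<in> UNIV \<rightarrow> T \<rightarrow> sets N" and B: "B \<in> T \<rightarrow> sets N"
    and disj: "disjoint_family (Pi\<^sub>E T \<circ> A)" and un: "(\<Union>i. Pi\<^sub>E T (A i)) = Pi\<^sub>E T B"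
  have A': "A k i \<in> sets N" if "i \<in> T" for k i using A that by (auto simp: Pi_iff)
  have B': "B i \<in> sets N" if "i \<in> T" for i using B that by (auto simp: Pi_iff)
  show "(\<Sum>n. ennreal (weight (A n))) = ennreal (weight B)"
  proof (rule antisym)
    show "(\<Sum>n. ennreal (weight (A n))) \<le> ennreal (weight B)"
      using disj un by (intro suminf_weight_le A' B') (auto simp: comp_def)
    show "ennreal (weight B) \<le> (\<Sum>n. ennreal (weight (A n)))"
      using un by (intro weight_le_suminf A' B') auto
  qed
qed auto

end

section \<open>Open sets of tuples are measurable\<close>

text \<open>Finite \<open>1 / m\<close>-nets for all \<open>m\<close> provide the centres. A countable base makes an open set of tuples a
  countable union of rectangles, so that the measure on tuples, which lives on the \<open>\<sigma>\<close>-algebra generated by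
  rectangles, is monotone on open sets.\<close>

lemma compact_countable_base:
  assumes "compact (UNIV :: 'x::metric_space set)"
  shows "\<exists>\<B> :: 'x set set. countable \<B> \<and> (\<forall>b\<in>\<B>. open b) \<and>
    (\<forall>V x. open V \<and> x \<in> V \<longrightarrow> (\<exists>b\<in>\<B>. x \<in> b \<and> b \<subseteq> V))"
proof -
  have "\<exists>k. finite k \<and> (UNIV :: 'x set) \<subseteq> (\<Union>x\<in>k. ball x (1 / real (Suc m)))" for m
    using assms unfolding compact_eq_totally_bounded by simp
  then obtain k :: "nat \<Rightarrow> 'x set" where k: "\<And>m. finite (k m)"
    "\<And>m. UNIV \<subseteq> (\<Union>x\<in>k m. ball x (1 / real (Suc m)))" by metis
  define \<B> where "\<B> = (\<Union>m. (\<lambda>x. ball x (1 / real (Suc m))) ` k m)"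
  have "countable \<B>" unfolding \<B>_def using k(1) by (auto intro: countable_finite)
  moreover have "\<forall>b\<in>\<B>. open b" by (auto simp: \<B>_def)
  moreover have "\<exists>b\<in>\<B>. x \<in> b \<and> b \<subseteq> V" if V: "open V" "x \<in> V" for V x
  proof -
    obtain e where e: "0 < e" "ball x e \<subseteq> V" using V openE by blast
    obtain m where m: "1 / real (Suc m) < e / 2" using nat_approx_posE[of "e / 2"] e by auto
    have "x \<in> (\<Union>y\<in>k m. ball y (1 / real (Suc m)))" using k(2) UNIV_I by (rule subsetD)
    then obtain y where y: "y \<in> k m" "x \<in> ball y (1 / real (Suc m))" by blast
    have "ball y (1 / real (Suc m)) \<subseteq> ball x e"
    proof
      fix z assume z: "z \<in> ball y (1 / real (Suc m))"
      have "dist x z \<le> dist y x + dist y z" by (metis dist_commute dist_triangle)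
      then show "z \<in> ball x e" using y(2) z m unfolding mem_ball by linarith
    qed
    then have "ball y (1 / real (Suc m)) \<subseteq> V" using e by simp
    moreover have "ball y (1 / real (Suc m)) \<in> \<B>" using y by (auto simp: \<B>_def)
    ultimately show ?thesis using y(2) by blast
  qed
  ultimately show ?thesis by (intro exI[of _ \<B>]) auto
qed

context regular_cond_exp_product
begin

lemma openin_sigma_rectangles:
  assumes U: "openin (product_topology (\<lambda>_. euclidean) T) U"
  shows "U \<in> sigma_sets (T \<rightarrow>\<^sub>E UNIV) (Pi\<^sub>E T ` (T \<rightarrow> sets N))"
proof -
  obtain \<B> :: "'x set set" where cB: "countable \<B>" and oB: "\<And>b. b \<in> \<B> \<Longrightarrow> open b"
    and base: "\<And>V x. open V \<Longrightarrow> x \<in> V \<Longrightarrow> \<exists>b\<in>\<B>. x \<in> b \<and> b \<subseteq> V"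
    using compact_countable_base[OF compact_UNIV] by metis
  define \<R> where "\<R> = {b \<in> T \<rightarrow>\<^sub>E \<B>. Pi\<^sub>E T b \<subseteq> U}"
  have "countable (T \<rightarrow>\<^sub>E \<B>)" using finite_T cB by (intro countable_PiE)
  then have cR: "countable \<R>" unfolding \<R>_def by (rule countable_subset[rotated]) auto
  have "U = (\<Union>b\<in>\<R>. Pi\<^sub>E T b)"
  proof (intro subset_antisym subsetI)
    fix y assume y: "y \<in> U"
    obtain V where V_open: "\<forall>i\<in>T. openin euclidean (V i)" and V: "y \<in> Pi\<^sub>E T V" "Pi\<^sub>E T V \<subseteq> U"
      using bspec[OF U[unfolded openin_product_topology_alt] y] by blast
    have "\<exists>b\<in>\<B>. y i \<in> b \<and> b \<subseteq> V i" if "i \<in> T" for i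
      using base[of "V i" "y i"] V_open V(1) that by (auto simp: PiE_iff)
    then obtain b where b: "\<And>i. i \<in> T \<Longrightarrow> b i \<in> \<B>" "\<And>i. i \<in> T \<Longrightarrow> y i \<in> b i"
      "\<And>i. i \<in> T \<Longrightarrow> b i \<subseteq> V i" by metis
    have "Pi\<^sub>E T (restrict b T) \<subseteq> Pi\<^sub>E T V" using b(3) by (intro PiE_mono) auto
    then have "restrict b T \<in> \<R>" using b(1) V(2) by (auto simp: \<R>_def)
    moreover have "y \<in> Pi\<^sub>E T (restrict b T)" using b(2) V(1) by (auto simp: PiE_iff)
    ultimately show "y \<in> (\<Union>b\<in>\<R>. Pi\<^sub>E T b)" by blast
  qed (auto simp: \<R>_def)
  moreover have "(\<Union>b\<in>\<R>. Pi\<^sub>E T b) \<in> sigma_sets (T \<rightarrow>\<^sub>E UNIV) (Pi\<^sub>E T ` (T \<rightarrow> sets N))"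
  proof (rule sigma_sets_UNION)
    show "countable (Pi\<^sub>E T ` \<R>)" using cR by simp
    fix R assume "R \<in> Pi\<^sub>E T ` \<R>"
    then obtain b where b: "b \<in> T \<rightarrow>\<^sub>E \<B>" "R = Pi\<^sub>E T b" by (auto simp: \<R>_def)
    have "b \<in> T \<rightarrow> sets N" using b oB open_sets by (auto simp: PiE_iff)
    then show "R \<in> sigma_sets (T \<rightarrow>\<^sub>E UNIV) (Pi\<^sub>E T ` (T \<rightarrow> sets N))" using b by auto
  qed
  ultimately show ?thesis by simp
qed

end

section \<open>Weights of rectangles and partitions of entropy zero\<close>

text \<open>The two constructions meet here: the measure \<open>N\<close> is the completion of \<open>\<mu>\<close>, and conditional expectations
  are taken with respect to the sets of zero entropy.\<close>

locale pinsker_product =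
  amenable_pmp_action G N \<phi> + regular_cond_exp_product N P T
  for G :: "('g, 'b) monoid_scheme" (structure) and N :: "'x::metric_space measure"
    and \<phi> :: "'g \<Rightarrow> 'x \<Rightarrow> 'x" and P T +
  fixes \<mu> :: "'x measure"
  assumes N_completion: "N = completion \<mu>" and \<mu>_borel: "sets \<mu> = sets borel"
    and sets_P: "sets P = zero_entropy_sets"
begin

text \<open>On \<open>D i\<close>, which is \<open>P\<close>-measurable and disjoint from \<open>B i\<close>, the conditional expectation of the
  indicator of \<open>B i\<close> vanishes; since the \<open>D i\<close> cover, some factor of the product is zero at almost every
  point.\<close>

lemma weight_eq_0_if_zero_entropy_cover:
  assumes B: "\<And>i. i \<in> T \<Longrightarrow> B i \<in> sets N"
    and D: "\<And>i. i \<in> T \<Longrightarrow> D i \<in> zero_entropy_sets"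
    and disj: "\<And>i. i \<in> T \<Longrightarrow> B i \<inter> D i = {}" and cover: "(\<Union>i\<in>T. D i) = UNIV"
  shows "weight B = 0"
proof -
  have "AE x in N. 0 \<le> ce (B i) x \<and> ce (B i) x \<le> indicat_real (- D i) x" if i: "i \<in> T" for i
  proof -
    have DP: "- D i \<in> sets P" using zero_entropy_Compl[OF D[OF i]] sets_P by simp
    then have DN: "- D i \<in> sets N" using subalgebra by (auto simp: subalgebra_def)
    have "AE x in N. ce (- D i) x = indicat_real (- D i) x"
      using DP by (intro real_cond_exp_F_meas integrable_indicat DN) simp
    moreover have "AE x in N. ce (B i) x \<le> ce (- D i) x"
      using disj[OF i] by (intro real_cond_exp_mono integrable_indicat DN B i)
        (auto simp: indicator_def)
    ultimately show ?thesis using ce_nonneg[OF B[OF i]] by eventually_elim auto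
  qed
  then have "AE x in N. \<forall>i\<in>T. 0 \<le> ce (B i) x \<and> ce (B i) x \<le> indicat_real (- D i) x"
    by (intro AE_finite_allI finite_T)
  then have "AE x in N. (\<Prod>i\<in>T. ce (B i) x) = 0"
  proof eventually_elim
    case (elim x)
    obtain i where "i \<in> T" "x \<in> D i" using cover by blast
    then have "ce (B i) x = 0" using elim by force
    then show ?case using \<open>i \<in> T\<close> finite_T by (intro prod_zero) auto
  qed
  then show ?thesis unfolding weight_def by (rule integral_eq_zero_AE)
qed

lemma zero_entropy_Un_null:
  assumes "A \<in> zero_entropy_sets" "Z \<in> null_sets N" shows "A \<union> Z \<in> zero_entropy_sets"
  using zero_entropy_Un[OF assms(1) null_zero_entropy[OF assms(2)]] .

text \<open>Up to null sets the hull is the \<open>P\<close>-measurable set \<open>C\<close> where the conditional expectation is positive: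
  the integral of \<open>E(B)\<close> over the complement of \<open>C\<close> is 0 and equals the measure of \<open>B - C\<close>. A Borel
  representative containing \<open>B\<close> is chosen because entropy tuples test Borel partitions only.\<close>

lemma zero_entropy_hull:
  assumes B: "B \<in> sets N"
  shows "\<exists>E\<in>sets borel. B \<subseteq> E \<and> E \<in> zero_entropy_sets \<and> (AE x in N. x \<in> E \<longrightarrow> 0 < ce B x)"
proof -
  define C where "C = {x. 0 < ce B x}"
  have space_P: "space P = UNIV" using subalgebra by (simp add: subalgebra_def)
  have "C = {x \<in> space P. 0 < ce B x}" by (simp add: C_def space_P)
  also have "\<dots> \<in> sets P" by measurable
  finally have CP: "C \<in> sets P" .
  then have C: "C \<in> zero_entropy_sets" "C \<in> sets N"
    using sets_P by (auto simp: zero_entropy_sets_def)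
  have C': "- C \<in> sets P" using zero_entropy_Compl[OF C(1)] sets_P by simp
  have BC: "B - C \<in> sets N" using B C by auto
  have "measure N (B - C) = (\<integral>x. indicat_real (- C) x * indicat_real B x \<partial>N)"
  proof -
    have "(\<lambda>x. indicat_real (- C) x * indicat_real B x) = indicat_real (B - C)"
      by (auto simp: indicator_def)
    then show ?thesis using BC by simp
  qed
  also have "\<dots> = (\<integral>x. indicat_real (- C) x * ce B x \<partial>N)"
  proof (rule real_cond_exp_intg(2)[symmetric])
    have "(\<lambda>x. indicat_real (- C) x * indicat_real B x) = indicat_real (B - C)"
      by (auto simp: indicator_def)
    then show "integrable N (\<lambda>x. indicat_real (- C) x * indicat_real B x)"
      using integrable_indicat[OF BC] by simp
  qed (use C' B in auto)
  also have "\<dots> = 0"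
  proof (rule integral_eq_zero_AE)
    show "AE x in N. indicat_real (- C) x * ce B x = 0"
      using ce_nonneg[OF B] by eventually_elim (auto simp: C_def indicator_def)
  qed
  finally have "measure N (B - C) = 0" .
  then have null: "B - C \<in> null_sets N"
    using BC by (intro null_setsI) (simp_all add: emeasure_eq_measure)
  have D: "C \<union> (B - C) \<in> zero_entropy_sets" by (rule zero_entropy_Un_null[OF C(1) null])
  then have DN: "C \<union> (B - C) \<in> sets N" by (simp add: zero_entropy_sets_def)
  have "C \<union> (B - C) \<in> sets (completion \<mu>)" using DN by (simp only: N_completion)
  then obtain E where E: "C \<union> (B - C) \<subseteq> E" "E \<in> sets \<mu>"
    and "E - (C \<union> (B - C)) \<in> null_sets (completion \<mu>)" by (rule completion_upper)
  then have nullE: "E - (C \<union> (B - C)) \<in> null_sets N" by (simp only: N_completion)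
  have "(C \<union> (B - C)) \<union> (E - (C \<union> (B - C))) = E" using E(1) by (simp only: Un_Diff_cancel Un_absorb1)
  then have "E \<in> zero_entropy_sets" using zero_entropy_Un_null[OF D nullE] by (simp only:)
  moreover have "AE x in N. x \<in> E \<longrightarrow> 0 < ce B x"
    using AE_not_in[OF null] AE_not_in[OF nullE] by eventually_elim (auto simp: C_def)
  ultimately show ?thesis using E \<mu>_borel by blast
qed

text \<open>The complements of the hulls \<open>E i\<close> cover everything but the null set \<open>Z\<close>. On \<open>Z\<close> the sets \<open>U i\<close> have
  empty intersection, so adding the null sets \<open>Z - U i\<close> completes the cover \<open>V\<close> without meeting \<open>U i\<close>. The
  partition assigns to a point the least index of a member of \<open>V\<close> containing it.\<close>

lemma zero_entropy_partition_if_weight_0: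
  assumes U: "\<And>i. i \<in> T \<Longrightarrow> U i \<in> sets borel" and w: "weight U = 0"
    and empty: "(\<Inter>i\<in>T. U i) = {}"
  shows "\<exists>\<alpha>. finite_Borel_partition \<alpha> \<and> (\<forall>A\<in>\<alpha>. \<exists>i\<in>T. A \<inter> U i = {})
    \<and> entropy_of_partition G \<phi> \<mu> \<alpha> = 0"
proof -
  interpret Z: sigma_algebra UNIV zero_entropy_sets by (rule sigma_algebra_zero_entropy)
  have UN: "U i \<in> sets N" if "i \<in> T" for i using U[OF that] borel_sets by auto
  have "\<forall>i\<in>T. \<exists>E. E \<in> sets borel \<and> U i \<subseteq> E \<and> E \<in> zero_entropy_sets
      \<and> (AE x in N. x \<in> E \<longrightarrow> 0 < ce (U i) x)"
    using zero_entropy_hull[OF UN] by blast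
  from bchoice[OF this] obtain E where E': "\<forall>i\<in>T. E i \<in> sets borel \<and> U i \<subseteq> E i
      \<and> E i \<in> zero_entropy_sets \<and> (AE x in N. x \<in> E i \<longrightarrow> 0 < ce (U i) x)" ..
  have E: "E i \<in> sets borel" "U i \<subseteq> E i" "E i \<in> zero_entropy_sets"
    "AE x in N. x \<in> E i \<longrightarrow> 0 < ce (U i) x" if "i \<in> T" for i
    using bspec[OF E' that] by blast+
  define Z where "Z = (\<Inter>i\<in>T. E i)"
  have Z_borel: "Z \<in> sets borel" unfolding Z_def using E finite_T T_nonempty by (intro sets.finite_INT) auto
  have "AE x in N. (\<Prod>i\<in>T. ce (U i) x) = 0"
  proof -
    have nn: "AE x in N. 0 \<le> (\<Prod>i\<in>T. ce (U i) x)"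
      using prod_ce_bounds[of U, OF UN] by (rule AE_mp) auto
    show ?thesis
      using integral_nonneg_eq_0_iff_AE[OF integrable_prod_ce[OF UN] nn] w
      unfolding weight_def by simp
  qed
  moreover have "AE x in N. \<forall>i\<in>T. x \<in> E i \<longrightarrow> 0 < ce (U i) x"
    by (intro AE_finite_allI finite_T E)
  ultimately have "AE x in N. x \<notin> Z"
  proof eventually_elim
    case (elim x)
    show ?case
    proof
      assume "x \<in> Z"
      then have "0 < (\<Prod>i\<in>T. ce (U i) x)" using elim(2) by (intro prod_pos) (auto simp: Z_def)
      then show False using elim(1) by simp
    qed
  qed
  then have Z_null: "Z \<in> null_sets N" using Z_borel borel_sets by (subst AE_iff_null_sets) auto
  define V where "V i = - E i \<union> (Z - U i)" for i
  have V_borel: "V i \<in> sets borel" if "i \<in> T" for i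
    unfolding V_def using E(1)[OF that] Z_borel U[OF that] by auto
  have V_zero: "V i \<in> zero_entropy_sets" if "i \<in> T" for i
    unfolding V_def
    using Z_null UN[OF that] by (intro zero_entropy_Un_null zero_entropy_Compl E that null_set_Diff)
  have V_disj: "V i \<inter> U i = {}" if "i \<in> T" for i using E(2)[OF that] by (auto simp: V_def)
  have V_cover: "\<exists>i. i \<in> T \<and> x \<in> V i" for x
  proof (cases "x \<in> Z")
    case True
    obtain i where "i \<in> T" "x \<notin> U i" using empty by blast
    then show ?thesis using True by (auto simp: V_def)
  next
    case False
    then show ?thesis by (auto simp: V_def Z_def)
  qed
  define m where "m x = (LEAST i. i \<in> T \<and> x \<in> V i)" for x
  have m: "m x \<in> T" "x \<in> V (m x)" for x
    using LeastI_ex[OF V_cover[of x]] by (auto simp: m_def)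
  have fibre: "m -` {i} = V i - (\<Union>j\<in>{j\<in>T. j < i}. V j)" if "i \<in> T" for i
  proof (intro subset_antisym subsetI)
    fix x assume x: "x \<in> m -` {i}"
    then have "x \<in> V i" using m(2)[of x] by simp
    moreover have "x \<notin> V j" if "j \<in> T" "j < i" for j
      using that x not_less_Least[of j "\<lambda>i. i \<in> T \<and> x \<in> V i"] by (auto simp: m_def)
    ultimately show "x \<in> V i - (\<Union>j\<in>{j\<in>T. j < i}. V j)" by auto
  next
    fix x assume x: "x \<in> V i - (\<Union>j\<in>{j\<in>T. j < i}. V j)"
    have "m x \<le> i" unfolding m_def using x that by (intro Least_le) auto
    moreover have "\<not> m x < i" using x m[of x] by auto
    ultimately show "x \<in> m -` {i}" by simp
  qed
  have fibre_zero: "m -` {i} \<in> zero_entropy_sets" for i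
  proof (cases "i \<in> T")
    case True
    then show ?thesis unfolding fibre[OF True] using V_zero finite_T by (intro Z.Diff Z.finite_UN) auto
  next
    case False
    then have "m -` {i} = {}" using m(1) by auto
    then show ?thesis by simp
  qed
  have fibre_borel: "m -` {i} \<in> sets borel" if "i \<in> T" for i
    unfolding fibre[OF that] using V_borel finite_T that by (intro sets.Diff sets.finite_UN) auto
  have rm: "range m \<subseteq> T" using m(1) by auto
  then have fin: "finite (range m)" using finite_T by (rule finite_subset)
  have simple: "simple_function N m"
    using fin fibre_zero by (auto simp: simple_function_def zero_entropy_sets_def)
  define \<alpha> where "\<alpha> = (\<lambda>i. m -` {i}) ` range m"
  have ne: "\<alpha> = \<alpha> - {{}}" by (auto simp: \<alpha>_def)
  have "finite_Borel_partition \<alpha>"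
    unfolding finite_Borel_partition_def
  proof (intro conjI)
    show "finite \<alpha>" using fin by (simp add: \<alpha>_def)
    show "\<alpha> \<subseteq> sets borel" using fibre_borel rm by (auto simp: \<alpha>_def)
    show "partition_on UNIV \<alpha>"
      by (rule partition_onI) (auto simp: \<alpha>_def disjnt_def)
  qed
  moreover have "\<exists>i\<in>T. A \<inter> U i = {}" if A: "A \<in> \<alpha>" for A
  proof -
    obtain x where "A = m -` {m x}" using A by (auto simp: \<alpha>_def)
    then have "A \<subseteq> V (m x)" using fibre[OF m(1)[of x]] by auto
    then show ?thesis using V_disj[OF m(1)[of x]] m(1)[of x] by blast
  qed
  moreover have "entropy_of_partition G \<phi> \<mu> \<alpha> = entropy_rate m"
    using fin ne by (intro entropy_of_partition_eq_rate[OF N_completion _ simple]) (auto simp: \<alpha>_def)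
  moreover have "entropy_rate m = 0" by (rule entropy_rate_eq_0_if_cells[OF simple fibre_zero])
  ultimately show ?thesis by auto
qed

text \<open>Membership in a union of cells is a function of the cell, so its entropy rate is at most that of \<open>\<alpha>\<close>.\<close>

lemma Union_cells_zero_entropy:
  assumes \<alpha>: "finite_Borel_partition \<alpha>" and h: "\<not> 0 < entropy_of_partition G \<phi> \<mu> \<alpha>"
    and sub: "\<beta> \<subseteq> \<alpha>"
  shows "\<Union>\<beta> \<in> zero_entropy_sets"
proof -
  have fin: "finite \<alpha>" and borel: "\<alpha> \<subseteq> sets borel" and part: "partition_on UNIV \<alpha>"
    using \<alpha> by (auto simp: finite_Borel_partition_def)
  have "\<exists>A. A \<in> \<alpha> \<and> x \<in> A" for x using part by (auto simp: partition_on_def)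
  then obtain f where f: "\<And>x. f x \<in> \<alpha>" "\<And>x. x \<in> f x" by metis
  have unique: "A = B" if "A \<in> \<alpha>" "B \<in> \<alpha>" "x \<in> A" "x \<in> B" for A B x
    using partition_onD2[OF part] that by (auto simp: disjoint_def)
  have fibre: "f -` {A} = A" if "A \<in> \<alpha>" for A
  proof (intro subset_antisym subsetI)
    fix x assume "x \<in> f -` {A}"
    then show "x \<in> A" using f(2)[of x] by simp
  next
    fix x assume "x \<in> A"
    then have "A = f x" using unique[OF that f(1) _ f(2)] by simp
    then show "x \<in> f -` {A}" by simp
  qed
  have "range f = \<alpha>"
  proof (intro subset_antisym subsetI)
    fix A assume A: "A \<in> \<alpha>"
    then have "A \<noteq> {}" using partition_onD3[OF part] by auto
    then obtain x where "x \<in> A" by blast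
    then have "f x = A" using fibre[OF A] by blast
    then show "A \<in> range f" by blast
  qed (use f in auto)
  then have cells: "(\<lambda>A. f -` {A}) ` range f = \<alpha> - {{}}"
    using fibre partition_onD3[OF part] by (auto simp: image_iff)
  have simple: "simple_function N f"
    using \<open>range f = \<alpha>\<close> fin fibre borel borel_sets by (auto simp: simple_function_def)
  have h0: "entropy_rate f \<le> 0"
    using h entropy_of_partition_eq_rate[OF N_completion fin simple cells] by simp
  have "finite \<beta>" using sub fin by (rule finite_subset)
  then have \<beta>: "\<Union>\<beta> \<in> sets N" using sub borel borel_sets by (intro sets.finite_Union) auto
  have iff: "x \<in> \<Union>\<beta> \<longleftrightarrow> f x \<in> \<beta>" for x
    using f unique sub by (metis Union_iff subsetD)
  have "entropy_rate (\<lambda>x. x \<in> \<Union>\<beta>) \<le> entropy_rate f"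
    by (rule entropy_rate_mono[OF simple simple_indicator[OF \<beta>]]) (simp only: iff)
  then show ?thesis
    using h0 entropy_rate_nonneg[OF simple_indicator[OF \<beta>]] \<beta> by (simp add: zero_entropy_sets_def)
qed

end

section \<open>Entropy tuples and the support\<close>

text \<open>Invariance and measurability of the action carry over from the Borel sets to the completion, and the
  completion inherits approximation by closed and open sets.\<close>

lemma pinsker_product_of_system:
  fixes G :: "('g, 'b) monoid_scheme" and \<phi> :: "'g \<Rightarrow> 'x::metric_space \<Rightarrow> 'x" and \<mu> :: "'x measure"
  assumes G: "group G" and amenable: "amenable G" and sys: "G_system G \<phi>"
    and \<mu>: "\<mu> \<in> invariant_measures G \<phi>" and n: "1 \<le> n"
  shows "pinsker_product G (completion \<mu>) \<phi> (Pinsker_algebra G \<phi> \<mu>) {1..n} \<mu>"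
proof -
  let ?N = "completion \<mu>"
  have compact: "compact (UNIV :: 'x set)" and act: "group_action G UNIV \<phi>"
    and cont: "continuous_map (prod_topology (discrete_topology (carrier G)) euclidean) euclidean
       (\<lambda>(g, x). \<phi> g x)"
    using sys by (auto simp: G_system_def)
  have prob: "prob_space \<mu>" and borel: "sets \<mu> = sets borel"
    and inv: "\<And>g. g \<in> carrier G \<Longrightarrow> distr \<mu> borel (\<phi> g) = \<mu>"
    using \<mu> by (auto simp: invariant_measures_def)
  interpret \<mu>: prob_space \<mu> by (rule prob)
  interpret act: group_action G UNIV \<phi> by (rule act)
  have space: "space \<mu> = UNIV" using sets_eq_imp_space_eq[OF borel] by simp
  have meas: "\<phi> g \<in> \<mu> \<rightarrow>\<^sub>M \<mu>" and distr: "distr \<mu> \<mu> (\<phi> g) = \<mu>" if g: "g \<in> carrier G" for g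
  proof -
    have "continuous_map euclidean (prod_topology (discrete_topology (carrier G)) euclidean) (\<lambda>x. (g, x))"
      using g by (intro continuous_map_pairedI) auto
    from continuous_map_compose[OF this cont] have "continuous_on UNIV (\<phi> g)"
      by (simp add: comp_def)
    then have "\<phi> g \<in> borel \<rightarrow>\<^sub>M borel" by (rule borel_measurable_continuous_onI)
    then show "\<phi> g \<in> \<mu> \<rightarrow>\<^sub>M \<mu>" by (simp add: measurable_cong_sets[OF borel borel])
    have "distr \<mu> \<mu> (\<phi> g) = distr \<mu> borel (\<phi> g)" by (rule distr_cong) (simp_all add: borel)
    then show "distr \<mu> \<mu> (\<phi> g) = \<mu>" using inv[OF g] by simp
  qed
  interpret pmp: amenable_pmp_action G ?N \<phi>
  proof (intro amenable_pmp_action.intro amenable_pmp_action_axioms.intro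
      full_prob_space.intro full_prob_space_axioms.intro G amenable)
    show "prob_space ?N" by (rule \<mu>.prob_space_completion)
    show "space ?N = UNIV" by (simp add: space)
    fix g assume g: "g \<in> carrier G"
    have m: "\<phi> g \<in> ?N \<rightarrow>\<^sub>M \<mu>" by (rule measurable_completion[OF meas[OF g]])
    have d: "distr ?N \<mu> (\<phi> g) = \<mu>" by (simp only: distr_completion[OF meas[OF g]] distr[OF g])
    show "\<phi> g \<in> ?N \<rightarrow>\<^sub>M ?N" by (rule completion.measurable_completion2[OF m]) (simp add: d)
    show "distr ?N ?N (\<phi> g) = ?N" using completion.completion_distr_eq[OF m] by (simp add: d)
    fix h x assume "h \<in> carrier G"
    then show "\<phi> (g \<otimes>\<^bsub>G\<^esub> h) x = \<phi> g (\<phi> h x)" using g by (intro act.composition_rule) auto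
  next
    fix x show "\<phi> \<one>\<^bsub>G\<^esub> x = x" using fun_cong[OF act.id_eq_one, of x] by simp
  qed
  have "sigma_sets UNIV (Pinsker_sets G \<phi> \<mu>) = pmp.zero_entropy_sets"
    unfolding pmp.Pinsker_sets_eq[OF refl]
    by (rule sigma_algebra.sigma_sets_eq[OF pmp.sigma_algebra_zero_entropy])
  then have P: "sets (Pinsker_algebra G \<phi> \<mu>) = pmp.zero_entropy_sets"
    by (simp add: Pinsker_algebra_def)
  show ?thesis
  proof (intro pinsker_product.intro pinsker_product_axioms.intro regular_cond_exp_product.intro
      cond_exp_product.intro cond_exp_product_axioms.intro regular_cond_exp_product_axioms.intro)
    show "amenable_pmp_action G ?N \<phi>" by (rule pmp.amenable_pmp_action_axioms)
    show "full_prob_space ?N" by (rule pmp.full_prob_space_axioms)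
    show "subalgebra ?N (Pinsker_algebra G \<phi> \<mu>)"
      using space P by (auto simp: subalgebra_def Pinsker_algebra_def pmp.zero_entropy_sets_def)
    show "compact (UNIV :: 'x set)" by (rule compact)
    show "sets borel \<subseteq> sets ?N" using borel by auto
    show "\<exists>F U. closed F \<and> open U \<and> F \<subseteq> A \<and> A \<subseteq> U \<and> measure ?N (U - F) < e"
      if "A \<in> sets ?N" "0 < e" for A and e :: real
      by (rule completion_closed_open_approx[OF \<mu>.finite_measure_axioms borel that])
    show "sets (Pinsker_algebra G \<phi> \<mu>) = pmp.zero_entropy_sets" by (rule P)
    show "sets \<mu> = sets borel" by (rule borel)
  qed (use n in auto)
qed

theorem theorem6p9:
  fixes G :: "('g, 'b) monoid_scheme"
    and \<phi> :: "'g \<Rightarrow> 'x::metric_space \<Rightarrow> 'x"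
    and \<mu> :: "'x measure"
    and n :: nat
  assumes "group G"
    and "countable (carrier G)"
    and "infinite (carrier G)"
    and "amenable G"
    and "G_system G \<phi>"
    and "n \<ge> 2"
    and "\<mu> \<in> invariant_measures G \<phi>"
  shows "entropy_tuples G \<phi> \<mu> n = tuple_support n (lambda_measure G \<phi> \<mu> n) - diagonal n"
proof -
  let ?T = "{1..n}"
  let ?X = "product_topology (\<lambda>_. euclidean :: 'x topology) ?T"
  interpret pinsker_product G "completion \<mu>" \<phi> "Pinsker_algebra G \<phi> \<mu>" ?T \<mu>
    using assms by (intro pinsker_product_of_system) auto
  define L where "L = lambda_measure G \<phi> \<mu> n"
  have L_eq: "L = extend_measure (?T \<rightarrow>\<^sub>E UNIV) (?T \<rightarrow> sets (completion \<mu>)) (\<lambda>A. Pi\<^sub>E ?T A)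
      (\<lambda>A. ennreal (weight A))"
    by (simp only: L_def lambda_measure_def tuples_def weight_def)
  have rect: "emeasure L (Pi\<^sub>E ?T A) = ennreal (weight A)" if "\<And>i. i \<in> ?T \<Longrightarrow> open (A i)" for A
    using that open_sets by (intro emeasure_extend_rectangle[OF L_eq]) (auto simp: Pi_iff)
  have L_sets: "U \<in> sets L" if "openin ?X U" for U
  proof -
    have "sets L = sigma_sets (?T \<rightarrow>\<^sub>E UNIV) (Pi\<^sub>E ?T ` (?T \<rightarrow> sets (completion \<mu>)))"
      unfolding L_eq by (rule sets_extend_measure) (auto simp: PiE_iff)
    then show ?thesis using openin_sigma_rectangles[OF that] by simp
  qed
  have "entropy_tuples G \<phi> \<mu> n = tuple_support n L - diagonal n"
  proof (intro subset_antisym subsetI)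
    fix x assume x: "x \<in> tuple_support n L - diagonal n"
    have "0 < entropy_of_partition G \<phi> \<mu> \<alpha>"
      if \<alpha>: "finite_Borel_partition \<alpha>" and adm: "admissible n x \<alpha>" for \<alpha>
    proof (rule ccontr)
      assume h: "\<not> 0 < entropy_of_partition G \<phi> \<mu> \<alpha>"
      let ?\<beta> = "\<lambda>i. {A \<in> \<alpha>. x i \<notin> closure A}"
      \<comment> \<open>\<open>?B i\<close> is the largest open neighbourhood of \<open>x i\<close> that avoids every closure missing \<open>x i\<close>.\<close>
      let ?B = "\<lambda>i. - (\<Union>A\<in>?\<beta> i. closure A)"
      have fin: "finite \<alpha>" using \<alpha> by (simp add: finite_Borel_partition_def)
      have B_open: "open (?B i)" for i using fin by (intro open_Compl closed_UN) auto
      have "weight ?B = 0"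
      proof (rule weight_eq_0_if_zero_entropy_cover)
        show "?B i \<in> sets (completion \<mu>)" for i by (rule open_sets[OF B_open])
        show "\<Union>(?\<beta> i) \<in> zero_entropy_sets" for i
          by (rule Union_cells_zero_entropy[OF \<alpha> h]) auto
        show "?B i \<inter> \<Union>(?\<beta> i) = {}" for i using closure_subset by blast
        show "(\<Union>i\<in>?T. \<Union>(?\<beta> i)) = UNIV"
        proof (intro subset_antisym subsetI)
          fix z :: 'x
          have "z \<in> \<Union>\<alpha>" using \<alpha> by (simp add: finite_Borel_partition_def partition_on_def)
          then obtain A where A: "A \<in> \<alpha>" "z \<in> A" by blast
          have "\<not> x ` ?T \<subseteq> closure A" using adm A(1) unfolding admissible_def by blast
          then obtain i where "i \<in> ?T" "x i \<notin> closure A" by blast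
          then show "z \<in> (\<Union>i\<in>?T. \<Union>(?\<beta> i))" using A by blast
        qed simp
      qed
      then have "emeasure L (Pi\<^sub>E ?T ?B) = 0" using rect[OF B_open] by simp
      moreover have "openin ?X (Pi\<^sub>E ?T ?B)" using B_open by (simp add: openin_PiE)
      moreover have "x \<in> Pi\<^sub>E ?T ?B" using x by (auto simp: tuple_support_def tuples_def PiE_iff)
      ultimately show False using x by (auto simp: tuple_support_def)
    qed
    then show "x \<in> entropy_tuples G \<phi> \<mu> n"
      using x by (auto simp: entropy_tuples_def tuple_support_def)
  next
    fix x assume x: "x \<in> entropy_tuples G \<phi> \<mu> n"
    then have xt: "x \<in> tuples n" and nd: "x \<notin> diagonal n" by (auto simp: entropy_tuples_def)
    have "0 < emeasure L U" if U: "openin ?X U" and xU: "x \<in> U" for U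
    proof (rule ccontr)
      assume "\<not> 0 < emeasure L U"
      then have U0: "emeasure L U = 0" by simp
      obtain V where V_open: "\<forall>i\<in>?T. openin euclidean (V i)" and xV: "x \<in> Pi\<^sub>E ?T V"
        and VU: "Pi\<^sub>E ?T V \<subseteq> U"
        using bspec[OF U[unfolded openin_product_topology_alt] xU] by blast
      obtain j k where jk: "j \<in> ?T" "k \<in> ?T" "x j \<noteq> x k"
        using xt nd by (auto simp: diagonal_def)
      obtain O1 O2 where O: "open O1" "open O2" "x j \<in> O1" "x k \<in> O2" "O1 \<inter> O2 = {}"
        using separation_t2[of "x j" "x k"] jk(3) by auto
      \<comment> \<open>Separating two distinct coordinates makes the sides have empty intersection.\<close>
      define W where "W i = V i \<inter> (if i = j then O1 else if i = k then O2 else UNIV)" for i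
      have W_open: "open (W i)" if "i \<in> ?T" for i
        using V_open O that by (auto simp: W_def)
      have xW: "x i \<in> W i" if "i \<in> ?T" for i
        using xV O that jk(3) by (auto simp: W_def PiE_iff)
      have "Pi\<^sub>E ?T W \<subseteq> U" using VU by (rule subset_trans[rotated]) (auto simp: W_def PiE_iff)
      then have "emeasure L (Pi\<^sub>E ?T W) \<le> emeasure L U" using L_sets[OF U] by (rule emeasure_mono)
      then have "ennreal (weight W) = 0" using U0 rect[OF W_open] by simp
      moreover have "0 \<le> weight W" by (rule weight_nonneg) (rule open_sets[OF W_open])
      ultimately have w: "weight W = 0" by (simp add: ennreal_eq_0_iff)
      have "W j \<inter> W k = {}" using O(5) jk(3) by (auto simp: W_def)
      then have "(\<Inter>i\<in>?T. W i) = {}" using jk by blast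
      from zero_entropy_partition_if_weight_0[OF _ w this] W_open
      obtain \<alpha> where \<alpha>: "finite_Borel_partition \<alpha>" "\<forall>A\<in>\<alpha>. \<exists>i\<in>?T. A \<inter> W i = {}"
        and h: "entropy_of_partition G \<phi> \<mu> \<alpha> = 0" by auto
      have "\<not> x ` ?T \<subseteq> closure A" if A: "A \<in> \<alpha>" for A
      proof -
        obtain i where i: "i \<in> ?T" "A \<inter> W i = {}" using \<alpha>(2) A by blast
        then have "W i \<inter> closure A = {}"
          using open_Int_closure_eq_empty[OF W_open[OF i(1)], of A] by blast
        then show ?thesis using xW[OF i(1)] i(1) by blast
      qed
      then have "admissible n x \<alpha>"
        using \<alpha>(1) by (auto simp: admissible_def finite_Borel_cover_def finite_Borel_partition_def
            partition_on_def)
      then have "0 < entropy_of_partition G \<phi> \<mu> \<alpha>" using x \<alpha>(1) by (auto simp: entropy_tuples_def)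
      then show False using h by simp
    qed
    then show "x \<in> tuple_support n L - diagonal n"
      using xt nd by (auto simp: tuple_support_def)
  qed
  then show ?thesis by (simp only: L_def)
qed

end
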